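(* Let $f:\mathbb{R}^n\to\mathbb{R}$ and $g_i:\mathbb{R}^n\to\mathbb{R}$, $i=1,\dots,m$, be convex and continuously differentiable, let $h(x)=Ax-b$ with $A\in\mathbb{R}^{p\times n}$, $b\in\mathbb{R}^p$, and suppose there exists $\bar x$ with $A\bar x=b$ and $g(\bar x)<0$. Let $z^\star=(x^\star,\nu^\star,\xi^\star)$ be a KKT point of the program $\min f(x)$ s.t. $Ax=b$, $g(x)\le0$, with $f$ and the $g_i$ twice differentiable at $x^\star$. If strict complementarity, LICQ, and SOSC hold at $z^\star$, then $z^\star$ is the unique KKT point and, for every $k_d^{eq}\ge0$ and $k_p^{eq},k_i^{eq},k_p^{in},k_i^{in}>0$, every trajectory of the SPPID dynamics (defined in the context) linearly-exponentially converges to $z^\star$.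
   Context: $\mathrm{ReLU}(y)=\max(y,0)$ componentwise; vector inequalities are entrywise; $J_g$ is the Jacobian of $g=(g_1,\dots,g_m)$. With $M:=I_n+k_d^{eq}A^\top A$, the SPPID dynamics with state $z=(x,\nu,\xi)\in\mathbb{R}^n\times\mathbb{R}^p\times\mathbb{R}^m$ are $$\dot x=-M^{-1}\Big(\nabla f(x)+A^\top\big(\nu+k_p^{eq}(Ax-b)\big)+J_g(x)^\top\mathrm{ReLU}(\xi+k_p^{in}g(x))\Big),$$ $$\dot\nu=k_i^{eq}(Ax-b),\qquad \dot\xi=-k_i^{in}\xi+k_i^{in}\mathrm{ReLU}(\xi+k_p^{in}g(x)).$$ KKT point: $\nabla f(x^\star)+A^\top\nu^\star+J_g(x^\star)^\top\xi^\star=0$, $Ax^\star=b$, $g(x^\star)\le0$, $\xi^\star\ge0$, $\xi_i^\star g_i(x^\star)=0$ for all $i$. Let $\mathcal{A}=\{i:g_i(x^\star)=0\}$. Strict complementarity: $\xi_i^\star>0$ for all $i\in\mathcal{A}$. LICQ: the rows of $A$ together with $\nabla g_i(x^\star)$, $i\in\mathcal{A}$, are linearly independent. SOSC: $d^\top\big(\nabla^2f(x^\star)+\sum_{i=1}^m\xi_i^\star\nabla^2g_i(x^\star)\big)d>0$ for all $d\ne0$ with $Ad=0$, $\nabla g_i(x^\star)^\top d=0$ for $i\in\mathcal{A}$ with $\xi_i^\star>0$, and $\nabla g_i(x^\star)^\top d\le0$ for $i\in\mathcal{A}$ with $\xi_i^\star=0$. Linear-exponential convergence of a trajectory $z(t)$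 to $z^\star$ (exponential convergence after an initial phase of linearly bounded decay): there exist $q>0$, $c_{lin}>0$, $c_{exp}>0$ and $0\le t_c<q/c_{lin}$ (possibly depending on the initial condition) such that $\|z(t)-z^\star\|\le q-c_{lin}t$ for $0\le t\le t_c$ and $\|z(t)-z^\star\|\le(q-c_{lin}t_c)e^{-c_{exp}(t-t_c)}$ for $t>t_c$. *)

theory Defs
  imports "HOL-Analysis.Analysis"
begin

section \<open>First and second derivatives of scalar functions\<close>

definition gradient :: "(real ^ 'n \<Rightarrow> real) \<Rightarrow> real ^ 'n \<Rightarrow> real ^ 'n" where
  "gradient f x = (\<chi> j. frechet_derivative f (at x) (axis j 1))"

definition hessian :: "(real ^ 'n \<Rightarrow> real) \<Rightarrow> real ^ 'n \<Rightarrow> real ^ 'n ^ 'n" where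
  "hessian f x = jacobian (gradient f) (at x)"

definition continuously_differentiable :: "(real ^ 'n \<Rightarrow> real) \<Rightarrow> bool" where
  "continuously_differentiable f \<longleftrightarrow>
     (\<forall>x. f differentiable (at x)) \<and> continuous_on UNIV (gradient f)"

definition twice_differentiable_at :: "(real ^ 'n \<Rightarrow> real) \<Rightarrow> real ^ 'n \<Rightarrow> bool" where
  "twice_differentiable_at f x \<longleftrightarrow>
     (\<forall>\<^sub>F y in nhds x. f differentiable (at y)) \<and> gradient f differentiable (at x)"

lemma gderiv_gradient:
  assumes "f differentiable (at x)"
  shows "GDERIV f x :> gradient f x"
proof -
  let ?D = "frechet_derivative f (at x)"
  have D: "(f has_derivative ?D) (at x)"
    using assms by (simp add: frechet_derivative_works)
  then have lin: "linear ?D"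
    by (rule has_derivative_linear)
  have "?D h = h \<bullet> gradient f x" for h
  proof -
    have "?D h = ?D (\<Sum>j\<in>UNIV. (h $ j) *\<^sub>R axis j 1)"
      by (metis basis_expansion scalar_mult_eq_scaleR)
    also have "\<dots> = (\<Sum>j\<in>UNIV. h $ j * ?D (axis j 1))"
      by (simp add: linear_sum[OF lin] linear_scale[OF lin])
    also have "\<dots> = h \<bullet> gradient f x"
      by (simp add: inner_vec_def gradient_def)
    finally show ?thesis .
  qed
  then have "?D = (\<lambda>h. h \<bullet> gradient f x)" by blast
  with D show ?thesis by (simp add: gderiv_def)
qed


section \<open>The convex program\<close>

text \<open>
  The program minimises \<open>f x\<close> subject to \<open>A x = b\<close> and \<open>g x \<le> 0\<close>. The constraint functions
  are the components \<open>\<lambda>x. g x $ i\<close> of \<open>g\<close>. Vector inequalities are written out componentwise,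
  because the strict order that the library puts on vectors is not the componentwise one.
\<close>

definition kkt_point ::
  "(real ^ 'n \<Rightarrow> real) \<Rightarrow> real ^ 'n ^ 'p \<Rightarrow> real ^ 'p \<Rightarrow> (real ^ 'n \<Rightarrow> real ^ 'm) \<Rightarrow>
   (real ^ 'n) \<times> (real ^ 'p) \<times> (real ^ 'm) \<Rightarrow> bool" where
  "kkt_point f A b g = (\<lambda>(x, \<nu>, \<xi>).
     gradient f x + transpose A *v \<nu> + transpose (jacobian g (at x)) *v \<xi> = 0 \<and>
     A *v x = b \<and>
     (\<forall>i. g x $ i \<le> 0) \<and>
     (\<forall>i. \<xi> $ i \<ge> 0) \<and>
     (\<forall>i. \<xi> $ i * g x $ i = 0))"

definition active_set :: "(real ^ 'n \<Rightarrow> real ^ 'm) \<Rightarrow> real ^ 'n \<Rightarrow> 'm set" where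
  "active_set g x = {i. g x $ i = 0}"

definition strict_complementarity ::
  "(real ^ 'n \<Rightarrow> real ^ 'm) \<Rightarrow> real ^ 'n \<Rightarrow> real ^ 'm \<Rightarrow> bool" where
  "strict_complementarity g x \<xi> \<longleftrightarrow> (\<forall>i\<in>active_set g x. \<xi> $ i > 0)"

text \<open>
  Linear independence is that of an indexed family, so coinciding vectors with different
  indices count as dependent; hence the injectivity requirement.
\<close>

definition licq ::
  "real ^ 'n ^ 'p \<Rightarrow> (real ^ 'n \<Rightarrow> real ^ 'm) \<Rightarrow> real ^ 'n \<Rightarrow> bool" where
  "licq A g x \<longleftrightarrow>
     (let v = case_sum (\<lambda>k. row k A) (\<lambda>i. gradient (\<lambda>y. g y $ i) x);
          I = UNIV <+> active_set g x
      in inj_on v I \<and> independent (v ` I))"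

definition sosc ::
  "(real ^ 'n \<Rightarrow> real) \<Rightarrow> real ^ 'n ^ 'p \<Rightarrow> (real ^ 'n \<Rightarrow> real ^ 'm) \<Rightarrow>
   real ^ 'n \<Rightarrow> real ^ 'm \<Rightarrow> bool" where
  "sosc f A g x \<xi> \<longleftrightarrow>
     (\<forall>d. d \<noteq> 0 \<and> A *v d = 0 \<and>
          (\<forall>i\<in>active_set g x. \<xi> $ i > 0 \<longrightarrow> gradient (\<lambda>y. g y $ i) x \<bullet> d = 0) \<and>
          (\<forall>i\<in>active_set g x. \<xi> $ i = 0 \<longrightarrow> gradient (\<lambda>y. g y $ i) x \<bullet> d \<le> 0)
        \<longrightarrow> d \<bullet> ((hessian f x + (\<Sum>i\<in>UNIV. \<xi> $ i *\<^sub>R hessian (\<lambda>y. g y $ i) x)) *v d) > 0)"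


section \<open>The SPPID dynamics\<close>

definition ReLU :: "real ^ 'm \<Rightarrow> real ^ 'm" where
  "ReLU y = (\<chi> i. max (y $ i) 0)"

definition sppid_field ::
  "(real ^ 'n \<Rightarrow> real) \<Rightarrow> real ^ 'n ^ 'p \<Rightarrow> real ^ 'p \<Rightarrow> (real ^ 'n \<Rightarrow> real ^ 'm) \<Rightarrow>
   real \<Rightarrow> real \<Rightarrow> real \<Rightarrow> real \<Rightarrow> real \<Rightarrow>
   (real ^ 'n) \<times> (real ^ 'p) \<times> (real ^ 'm) \<Rightarrow> (real ^ 'n) \<times> (real ^ 'p) \<times> (real ^ 'm)" where
  "sppid_field f A b g kd_eq kp_eq ki_eq kp_in ki_in = (\<lambda>(x, \<nu>, \<xi>).
     (- (matrix_inv (mat 1 + kd_eq *\<^sub>R (transpose A ** A)) *v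
          (gradient f x + transpose A *v (\<nu> + kp_eq *\<^sub>R (A *v x - b))
             + transpose (jacobian g (at x)) *v ReLU (\<xi> + kp_in *\<^sub>R g x))),
      ki_eq *\<^sub>R (A *v x - b),
      - (ki_in *\<^sub>R \<xi>) + ki_in *\<^sub>R ReLU (\<xi> + kp_in *\<^sub>R g x)))"

text \<open>
  A trajectory of \<open>z' = F z\<close> is a differentiable solution on \<open>[0, \<infinity>)\<close> (one-sided derivative
  at \<open>0\<close>); the values of \<open>z\<close> at negative times are irrelevant.
\<close>

definition trajectory :: "('a::real_normed_vector \<Rightarrow> 'a) \<Rightarrow> (real \<Rightarrow> 'a) \<Rightarrow> bool" where
  "trajectory F z \<longleftrightarrow> (\<forall>t\<ge>0. (z has_vector_derivative F (z t)) (at t within {0..}))"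

definition lin_exp_converges :: "(real \<Rightarrow> 'a::real_normed_vector) \<Rightarrow> 'a \<Rightarrow> bool" where
  "lin_exp_converges z z_star \<longleftrightarrow>
     (\<exists>q>0. \<exists>c_lin>0. \<exists>c_exp>0. \<exists>t_c\<ge>0. t_c < q / c_lin \<and>
        (\<forall>t. 0 \<le> t \<and> t \<le> t_c \<longrightarrow> norm (z t - z_star) \<le> q - c_lin * t) \<and>
        (\<forall>t>t_c. norm (z t - z_star) \<le> (q - c_lin * t_c) * exp (- c_exp * (t - t_c))))"

end

theory Submission
  imports Defs
begin

text \<open>
  With \<open>u = ReLU (\<xi> + k g(x))\<close>, the dynamics is the preconditioned saddle flow of the augmented
  Lagrangian, so a weighted squared distance \<open>V\<close> to \<open>z\<^sup>\<star>\<close> satisfies \<open>V' = -W\<close> with \<open>W \<ge> 0\<close>. Strict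
  complementarity and SOSC give \<open>x = x\<^sup>\<star>\<close> wherever \<open>W = 0\<close>, and LICQ leaves only \<open>z\<^sup>\<star>\<close> where also
  \<open>x' = 0\<close>. Barbalat's lemma yields \<open>W \<rightarrow> 0\<close>, hence \<open>x \<rightarrow> x\<^sup>\<star>\<close>; applied to \<open>x\<close> it yields \<open>x' \<rightarrow> 0\<close>,
  hence \<open>z \<rightarrow> z\<^sup>\<star>\<close>. No uniqueness of solutions or limit trajectory is needed.

  Near \<open>z\<^sup>\<star>\<close> the signs of \<open>\<xi>\<^sub>i + k g\<^sub>i(x)\<close> are frozen, and \<open>W\<close> dominates \<open>x - x\<^sup>\<star>\<close> and the
  inactive multipliers. The cross term \<open>S = (x - x\<^sup>\<star>)\<^sup>T M c\<close>, with
  \<open>c = A\<^sup>T(\<nu> - \<nu>\<^sup>\<star>) + \<Sum>\<^sub>i (\<xi>\<^sub>i - \<xi>\<^sub>i\<^sup>\<star>) \<nabla>g\<^sub>i(x\<^sup>\<star>)\<close> over the active \<open>i\<close>, contributes \<open>-\<parallel>c\<parallel>\<^sup>2\<close>, which by LICQ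
  dominates the remaining multipliers; so \<open>V + \<epsilon> S\<close> decays exponentially once \<open>z\<close> is near \<open>z\<^sup>\<star>\<close>.
  Since the constants may depend on the trajectory, a large enough prefactor absorbs the
  initial phase and \<open>t\<^sub>c = 0\<close> works.
\<close>

section \<open>Limits and differential inequalities\<close>

text \<open>Uniform continuity makes \<open>\<psi>\<close> nearly constant on windows of a fixed
  length \<open>h\<close>, so \<open>h *\<^sub>R \<psi> t\<close> is close to the increment of
  \<open>\<phi>\<close> over the window; these increments vanish because \<open>\<phi>\<close>
  converges.\<close>

lemma barbalat:
  fixes \<phi> :: "real \<Rightarrow> 'a::real_normed_vector"
  assumes deriv: "\<And>t. t \<ge> 0 \<Longrightarrow> (\<phi> has_vector_derivative \<psi> t) (at t within {0..})"
    and uc: "uniformly_continuous_on {0..} \<psi>"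
    and lim: "(\<phi> \<longlongrightarrow> l) at_top"
  shows "(\<psi> \<longlongrightarrow> 0) at_top"
proof (rule tendstoI)
  fix e :: real
  assume "e > 0"
  then obtain \<delta> where \<delta>: "\<delta> > 0"
    "\<And>s t. \<lbrakk>s \<ge> 0; t \<ge> 0; dist s t < \<delta>\<rbrakk> \<Longrightarrow> dist (\<psi> s) (\<psi> t) < e / 2"
    using uc unfolding uniformly_continuous_on_def by (metis atLeast_iff half_gt_zero)
  define h where "h = \<delta> / 2"
  have h: "h > 0" "h < \<delta>" using \<delta> by (auto simp: h_def)
  have "((\<lambda>t. \<phi> (t + h)) \<longlongrightarrow> l) at_top"
    by (rule filterlim_compose[OF lim], rule filterlim_at_top_mono[OF filterlim_ident])
       (use h in \<open>auto intro: eventuallyI\<close>)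
  from tendsto_diff[OF this lim] have "((\<lambda>t. \<phi> (t + h) - \<phi> t) \<longlongrightarrow> 0) at_top" by simp
  then have "\<forall>\<^sub>F t in at_top. norm (\<phi> (t + h) - \<phi> t) < h * (e / 2)"
    using h \<open>e > 0\<close> by (auto dest!: tendstoD[where e = "h * (e/2)"])
  with eventually_ge_at_top[of 0] show "\<forall>\<^sub>F t in at_top. dist (\<psi> t) 0 < e"
  proof eventually_elim
    case (elim t)
    have "norm (\<phi> (t + h) - \<phi> t - (t + h - t) *\<^sub>R \<psi> t) \<le> norm (t + h - t) * (e / 2)"
    proof (rule vector_differentiable_bound_linearization[where S = "{t..t+h}"])
      show "(\<phi> has_vector_derivative \<psi> s) (at s within {t..t+h})" if "s \<in> {t..t+h}" for s
        using that elim by (intro has_vector_derivative_within_subset[OF deriv]) auto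
      show "norm (\<psi> s - \<psi> t) \<le> e / 2" if "s \<in> {t..t+h}" for s
        using \<delta>(2)[of s t] that elim h by (auto simp: dist_norm intro: less_imp_le)
    qed (use h in \<open>auto simp: closed_segment_eq_real_ivl\<close>)
    then have "norm (h *\<^sub>R \<psi> t) \<le> h * (e / 2) + norm (\<phi> (t + h) - \<phi> t)"
      using h norm_triangle_ineq4[of "\<phi> (t + h) - \<phi> t" "\<phi> (t + h) - \<phi> t - h *\<^sub>R \<psi> t"] by simp
    also have "\<dots> < h * e" using elim by (simp add: field_simps)
    finally show ?case using h by simp
  qed
qed

text \<open>On the compact part of \<open>K\<close> where \<open>\<bar>q y\<bar> \<ge> e\<close>,
  the function \<open>\<bar>p y\<bar>\<close> has a positive minimum, so values of \<open>p\<close>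
  below it exclude that part.\<close>

lemma tendsto_zero_via_compact:
  fixes p q :: "'a::metric_space \<Rightarrow> real"
  assumes K: "compact K" "continuous_on K p" "continuous_on K q"
    and p0: "\<And>y. y \<in> K \<Longrightarrow> p y = 0 \<Longrightarrow> q y = 0"
    and z: "\<forall>\<^sub>F t in F. z t \<in> K"
    and lim: "((\<lambda>t. p (z t)) \<longlongrightarrow> 0) F"
  shows "((\<lambda>t. q (z t)) \<longlongrightarrow> 0) F"
proof (rule tendstoI)
  fix e :: real
  assume "e > 0"
  define L where "L = {y \<in> K. e \<le> \<bar>q y\<bar>}"
  have "L = K \<inter> (\<lambda>y. \<bar>q y\<bar>) -` {e..}" by (auto simp: L_def)
  then have "closedin (top_of_set K) L"
    using continuous_closedin_preimage[OF continuous_on_rabs[OF K(3)], of "{e..}"] by simp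
  with \<open>compact K\<close> have L: "compact L"
    using closedin_compact by blast
  have "\<exists>m>0. \<forall>y\<in>L. m \<le> \<bar>p y\<bar>"
  proof (cases "L = {}")
    case True
    then show ?thesis by (intro exI[of _ 1]) simp
  next
    case False
    have "continuous_on L (\<lambda>y. \<bar>p y\<bar>)"
      by (rule continuous_on_rabs, rule continuous_on_subset[OF K(2)]) (auto simp: L_def)
    from continuous_attains_inf[OF L False this] obtain w
      where w: "w \<in> L" "\<forall>y\<in>L. \<bar>p w\<bar> \<le> \<bar>p y\<bar>" by blast
    have "p w \<noteq> 0" using w(1) p0[of w] \<open>e > 0\<close> by (auto simp: L_def)
    with w(2) show ?thesis by (intro exI[of _ "\<bar>p w\<bar>"]) simp
  qed
  then obtain m where m: "m > 0" "\<And>y. y \<in> L \<Longrightarrow> m \<le> \<bar>p y\<bar>" by blast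
  show "\<forall>\<^sub>F t in F. dist (q (z t)) 0 < e"
    using z tendstoD[OF lim m(1)]
  proof eventually_elim
    case (elim t)
    then show ?case using m(2)[of "z t"] by (force simp: L_def)
  qed
qed

lemma nonincreasing_from_derivative:
  fixes \<phi> :: "real \<Rightarrow> real"
  assumes deriv: "\<And>t. t \<ge> T \<Longrightarrow> (\<phi> has_real_derivative \<psi> t) (at t within {T..})"
    and np: "\<And>t. t \<ge> T \<Longrightarrow> \<psi> t \<le> 0"
    and "T \<le> s" "s \<le> t"
  shows "\<phi> t \<le> \<phi> s"
proof (rule DERIV_nonpos_imp_decreasing_open[OF \<open>s \<le> t\<close>])
  show "\<exists>y. (\<phi> has_real_derivative y) (at x) \<and> y \<le> 0" if "s < x" "x < t" for x
  proof -
    have "at x within {T..} = at x"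
      using that \<open>T \<le> s\<close> by (intro at_within_interior) auto
    then show ?thesis using deriv[of x] np[of x] that \<open>T \<le> s\<close> by auto
  qed
  have "continuous_on {T..} \<phi>"
    using deriv by (intro continuous_on_eq_continuous_within[THEN iffD2]) (auto intro: DERIV_continuous)
  then show "continuous_on {s..t} \<phi>"
    by (rule continuous_on_subset) (use \<open>T \<le> s\<close> in auto)
qed

text \<open>Gronwall's inequality: multiplying by the integrating factor
  \<open>exp (\<alpha> * (t - T))\<close> gives a nonincreasing function.\<close>

lemma exponential_decay_from_derivative:
  fixes \<phi> :: "real \<Rightarrow> real"
  assumes deriv: "\<And>t. t \<ge> T \<Longrightarrow> (\<phi> has_real_derivative \<psi> t) (at t within {T..})"
    and le: "\<And>t. t \<ge> T \<Longrightarrow> \<psi> t \<le> - \<alpha> * \<phi> t"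
    and "T \<le> t"
  shows "\<phi> t \<le> \<phi> T * exp (- \<alpha> * (t - T))"
proof -
  have "\<phi> t * exp (\<alpha> * (t - T)) \<le> \<phi> T * exp (\<alpha> * (T - T))"
  proof (rule nonincreasing_from_derivative[where \<phi> = "\<lambda>t. \<phi> t * exp (\<alpha> * (t - T))" and T = T
        and \<psi> = "\<lambda>t. (\<psi> t + \<alpha> * \<phi> t) * exp (\<alpha> * (t - T))"])
    show "((\<lambda>t. \<phi> t * exp (\<alpha> * (t - T))) has_real_derivative (\<psi> t + \<alpha> * \<phi> t) * exp (\<alpha> * (t - T)))
      (at t within {T..})" if "t \<ge> T" for t
      by (rule derivative_eq_intros deriv that refl)+ (simp add: algebra_simps)
    show "(\<psi> t + \<alpha> * \<phi> t) * exp (\<alpha> * (t - T)) \<le> 0" if "t \<ge> T" for t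
      using le[OF that] by (intro mult_nonpos_nonneg) auto
  qed (use \<open>T \<le> t\<close> in auto)
  then have "\<phi> t * exp (\<alpha> * (t - T)) * exp (- \<alpha> * (t - T)) \<le> \<phi> T * exp (- \<alpha> * (t - T))"
    by (intro mult_right_mono) auto
  then show ?thesis by (simp add: mult.assoc flip: exp_add)
qed

lemma nonincreasing_nonneg_convergent:
  fixes \<phi> :: "real \<Rightarrow> real"
  assumes mono: "\<And>s t. 0 \<le> s \<Longrightarrow> s \<le> t \<Longrightarrow> \<phi> t \<le> \<phi> s" and nn: "\<And>t. 0 \<le> t \<Longrightarrow> \<phi> t \<ge> 0"
  shows "\<exists>l. (\<phi> \<longlongrightarrow> l) at_top"
proof
  have bdd: "bdd_below (\<phi> ` {0..})" using nn by (auto intro!: bdd_belowI[of _ 0])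
  show "(\<phi> \<longlongrightarrow> (INF t\<in>{0..}. \<phi> t)) at_top"
  proof (rule decreasing_tendsto)
    show "\<forall>\<^sub>F t in at_top. (INF t\<in>{0..}. \<phi> t) \<le> \<phi> t"
      using eventually_ge_at_top[of 0] by eventually_elim (auto intro: cINF_lower[OF bdd])
    fix y assume "(INF t\<in>{0..}. \<phi> t) < y"
    then obtain s where s: "s \<ge> 0" "\<phi> s < y"
      using cINF_less_iff[OF _ bdd] by auto
    show "\<forall>\<^sub>F t in at_top. \<phi> t < y"
      using eventually_ge_at_top[of s]
    proof eventually_elim
      case (elim t)
      with mono[OF s(1)] s(2) show ?case by (meson order_le_less_trans)
    qed
  qed
qed

section \<open>Bounds near a point, the convergence notion, and calculus for vectors\<close>

lemma eventually_nhds_fst: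
  fixes a :: "'a::t1_space" and c :: "'b::t1_space"
  assumes "\<forall>\<^sub>F x in nhds a. P x"
  shows "\<forall>\<^sub>F z in nhds (a, c). P (fst z)"
proof -
  have "(fst \<longlongrightarrow> fst (a, c)) (at (a, c))"
    by (rule tendsto_fst[OF tendsto_ident_at])
  then have "filterlim fst (nhds a) (nhds (a, c))"
    by (simp add: tendsto_nhds_iff)
  then show ?thesis using assms by (rule eventually_compose_filterlim[rotated])
qed

lemma uniform_local_bound:
  fixes h :: "'i::finite \<Rightarrow> 'a \<Rightarrow> real"
  assumes "\<And>i. \<exists>K\<ge>0. \<forall>\<^sub>F x in F. h i x \<le> K * s x" and s: "\<And>x. s x \<ge> 0"
  shows "\<exists>K\<ge>0. \<forall>\<^sub>F x in F. \<forall>i. h i x \<le> K * s x"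
proof -
  obtain K where K: "\<And>i. K i \<ge> 0" "\<And>i. \<forall>\<^sub>F x in F. h i x \<le> K i * s x"
    using assms(1) by metis
  have "\<forall>\<^sub>F x in F. \<forall>i. h i x \<le> K i * s x"
    using K(2) by (rule eventually_all_finite)
  then have "\<forall>\<^sub>F x in F. \<forall>i. h i x \<le> (\<Sum>i\<in>UNIV. K i) * s x"
  proof eventually_elim
    case (elim x)
    have "K i * s x \<le> (\<Sum>i\<in>UNIV. K i) * s x" for i
      using K(1) s by (intro mult_right_mono member_le_sum) auto
    with elim show ?case by (meson order_trans)
  qed
  then show ?thesis using K(1) by (intro exI[of _ "\<Sum>i\<in>UNIV. K i"]) (auto intro: sum_nonneg)
qed

lemma eventually_nhds_radius:
  fixes x :: "'a::real_normed_vector"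
  assumes "r > 0" "\<And>d. norm d < r \<Longrightarrow> P (x + d)"
  shows "\<forall>\<^sub>F y in nhds x. P y"
  unfolding eventually_nhds_metric
proof (intro exI conjI allI impI)
  show "P y" if "dist y x < r" for y
    using assms(2)[of "y - x"] that by (simp add: dist_norm)
qed (use assms in auto)

lemma eventually_nhds_pos:
  fixes \<phi> :: "'a::topological_space \<Rightarrow> real"
  assumes "continuous_on UNIV \<phi>" "\<phi> x > 0"
  shows "\<forall>\<^sub>F y in nhds x. \<phi> y > 0"
proof -
  have "(\<phi> \<longlongrightarrow> \<phi> x) (nhds x)"
    using assms(1) by (simp add: continuous_on_def tendsto_nhds_iff)
  then show ?thesis using assms(2) by (rule order_tendstoD)
qed

lemma lin_exp_converges_of_exponential:
  assumes "a > 0" "q > 0" "\<And>t. t \<ge> 0 \<Longrightarrow> norm (z t - zs) \<le> q * exp (- a * t)"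
  shows "lin_exp_converges z zs"
  unfolding lin_exp_converges_def
proof (intro exI conjI allI impI)
  \<comment> \<open>The witnesses are \<open>c_lin = 1\<close> and \<open>t_c = 0\<close>: the
    linear phase shrinks to the instant \<open>t = 0\<close>, where the exponential bound already
    equals \<open>q\<close>.\<close>
  show "norm (z t - zs) \<le> q - 1 * t" if "0 \<le> t \<and> t \<le> 0" for t
    using assms(3)[of 0] order_antisym[of t 0] that by auto
  show "norm (z t - zs) \<le> (q - 1 * 0) * exp (- a * (t - 0))" if "0 < t" for t
    using assms(3)[of t] that by simp
qed (use assms in auto)

lemma has_vector_derivative_shift:
  "(h has_vector_derivative h') F' \<Longrightarrow> ((\<lambda>t. h t - c) has_vector_derivative h') F'"
  using has_vector_derivative_diff_const by blast

lemma has_real_derivative_inner: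
  assumes "(a has_vector_derivative a') (at t within S)" "(c has_vector_derivative c') (at t within S)"
  shows "((\<lambda>t. a t \<bullet> c t) has_real_derivative a t \<bullet> c' + a' \<bullet> c t) (at t within S)"
  using bounded_bilinear.has_vector_derivative[OF bounded_bilinear_inner assms]
  by (simp add: has_real_derivative_iff_has_vector_derivative)

lemma has_vector_derivative_matrix_vector:
  fixes B :: "real ^ 'a ^ 'b"
  assumes "(a has_vector_derivative a') F"
  shows "((\<lambda>t. B *v a t) has_vector_derivative B *v a') F"
  using bounded_linear.has_vector_derivative[OF matrix_vector_mul_bounded_linear assms] .

lemma norm_sq_vec: "(norm (v :: real ^ 'k))\<^sup>2 = (\<Sum>i\<in>UNIV. (v $ i)\<^sup>2)"
  by (simp only: power2_norm_eq_inner inner_vec_def) (simp add: power2_eq_square)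

text \<open>By compactness \<open>q\<close> has a positive minimum on the unit sphere, and
  homogeneity carries this bound to all vectors.\<close>

lemma posdef_form_ge_norm:
  fixes q :: "real ^ 'n \<Rightarrow> real"
  assumes "continuous_on UNIV q" "\<And>c d. q (c *\<^sub>R d) = c\<^sup>2 * q d" "\<And>d. d \<noteq> 0 \<Longrightarrow> q d > 0"
  shows "\<exists>w>0. \<forall>d. w * (norm d)\<^sup>2 \<le> q d"
proof -
  have "sphere (0 :: real ^ 'n) 1 \<noteq> {}" by simp
  then obtain e where e: "e \<in> sphere 0 1" "\<forall>d\<in>sphere 0 1. q e \<le> q d"
    using continuous_attains_inf[of "sphere 0 1" q] continuous_on_subset[OF assms(1)] by auto
  have "q e * (norm d)\<^sup>2 \<le> q d" for d
  proof (cases "d = 0")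
    case True
    then show ?thesis using assms(2)[of 0 d] by simp
  next
    case False
    have "q d = (norm d)\<^sup>2 * q ((1 / norm d) *\<^sub>R d)"
      by (simp flip: assms(2) add: False)
    moreover have "q e \<le> q ((1 / norm d) *\<^sub>R d)" using e(2) False by simp
    ultimately show ?thesis by (metis mult.commute mult_left_mono zero_le_power2)
  qed
  moreover have "e \<noteq> 0" using e(1) by auto
  ultimately show ?thesis using assms(3)[of e] by (intro exI[of _ "q e"]) simp
qed

section \<open>Convex functions and their Bregman divergence\<close>

lemma GDERIV_along_line:
  assumes "GDERIV \<phi> (x + s *\<^sub>R d) :> D"
  shows "((\<lambda>s. \<phi> (x + s *\<^sub>R d)) has_real_derivative D \<bullet> d) (at s)"
proof -
  have "(\<phi> has_derivative (\<lambda>h. h \<bullet> D)) (at (x + s *\<^sub>R d))"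
    using assms by (simp add: gderiv_def)
  moreover have "((\<lambda>s. x + s *\<^sub>R d) has_derivative (\<lambda>r. r *\<^sub>R d)) (at s)"
    by (auto intro!: derivative_eq_intros)
  ultimately have "((\<lambda>s. \<phi> (x + s *\<^sub>R d)) has_derivative (\<lambda>r. (r *\<^sub>R d) \<bullet> D)) (at s)"
    by (rule has_derivative_compose[rotated])
  then show ?thesis
    by (simp add: has_field_derivative_def inner_commute mult_commute_abs)
qed

text \<open>Restriction to the line through \<open>x\<close> and \<open>y\<close> reduces this to
  the tangent of a convex function of one variable.\<close>

lemma convex_on_GDERIV_ge:
  assumes conv: "convex_on UNIV \<phi>" and D: "GDERIV \<phi> x :> D"
  shows "\<phi> y \<ge> \<phi> x + D \<bullet> (y - x)"
proof -
  define h where "h s = \<phi> (x + s *\<^sub>R (y - x))" for s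
  have "convex_on UNIV h"
  proof (rule convex_onI)
    fix t :: real and s r
    assume t: "0 < t" "t < 1"
    have "x + ((1 - t) *\<^sub>R s + t *\<^sub>R r) *\<^sub>R (y - x)
        = (1 - t) *\<^sub>R (x + s *\<^sub>R (y - x)) + t *\<^sub>R (x + r *\<^sub>R (y - x))"
      by (simp add: algebra_simps)
    then show "h ((1 - t) *\<^sub>R s + t *\<^sub>R r) \<le> (1 - t) * h s + t * h r"
      unfolding h_def using convex_onD[OF conv, of t] t by simp
  qed simp
  moreover have "(h has_real_derivative D \<bullet> (y - x)) (at 0)"
    unfolding h_def by (rule GDERIV_along_line) (use D in simp)
  ultimately have "h 1 - h 0 \<ge> (D \<bullet> (y - x)) * (1 - 0)"
    by (intro convex_on_imp_above_tangent[where A = UNIV]) auto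
  then show ?thesis by (simp add: h_def)
qed

definition bregman :: "(real ^ 'n \<Rightarrow> real) \<Rightarrow> real ^ 'n \<Rightarrow> real ^ 'n \<Rightarrow> real" where
  "bregman \<phi> x y = \<phi> y - \<phi> x - gradient \<phi> x \<bullet> (y - x)"

context
  fixes \<phi> :: "real ^ 'n \<Rightarrow> real"
  assumes conv: "convex_on UNIV \<phi>" and diff: "continuously_differentiable \<phi>"
begin

lemma convex_ge_tangent: "\<phi> y \<ge> \<phi> x + gradient \<phi> x \<bullet> (y - x)"
  using diff by (intro convex_on_GDERIV_ge conv gderiv_gradient) (simp add: continuously_differentiable_def)

lemma bregman_nonneg: "bregman \<phi> x y \<ge> 0"
  using convex_ge_tangent[of x y] by (simp add: bregman_def)

lemma gradient_monotone: "(gradient \<phi> y - gradient \<phi> x) \<bullet> (y - x) \<ge> 0"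
  using convex_ge_tangent[of x y] convex_ge_tangent[of y x] by (simp add: algebra_simps)

text \<open>
  Two tangents, meeting at the midpoint, turn the first-order expansion of the gradient into a
  second-order lower bound for \<open>\<phi>\<close>, at the cost of the factor \<open>1/4\<close> instead of \<open>1/2\<close>.
\<close>

lemma bregman_ge_half_gradient:
  "bregman \<phi> x (x + d) \<ge> (gradient \<phi> (x + (1/2) *\<^sub>R d) - gradient \<phi> x) \<bullet> ((1/2) *\<^sub>R d)"
proof -
  have *: "x + d - (x + (1/2) *\<^sub>R d) = (1/2) *\<^sub>R d"
    by (simp add: vec_eq_iff)
  show ?thesis
    using convex_ge_tangent[of "x + (1/2) *\<^sub>R d" "x + d"] convex_ge_tangent[of x "x + (1/2) *\<^sub>R d"]
    unfolding * by (simp add: bregman_def inner_diff_left)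
qed

text \<open>A divergence that vanishes at \<open>x + d\<close> thus vanishes on the whole segment,
  in particular at points close enough to \<open>x\<close> for the local expansion to apply.\<close>

lemma bregman_along_line_le:
  assumes "0 \<le> s" "s \<le> 1"
  shows "bregman \<phi> x (x + s *\<^sub>R d) \<le> s * bregman \<phi> x (x + d)"
proof -
  have "x + s *\<^sub>R d = (1 - s) *\<^sub>R x + s *\<^sub>R (x + d)" by (simp add: algebra_simps)
  then have "\<phi> (x + s *\<^sub>R d) \<le> (1 - s) * \<phi> x + s * \<phi> (x + d)"
    using convex_onD[OF conv, of s x "x + d"] assms by simp
  then show ?thesis by (simp add: bregman_def algebra_simps)
qed

context
  fixes x :: "real ^ 'n"
  assumes twice: "twice_differentiable_at \<phi> x"
begin

lemma gradient_has_derivative: "(gradient \<phi> has_derivative (\<lambda>d. hessian \<phi> x *v d)) (at x)"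
  using twice jacobian_works[of "gradient \<phi>" "at x"]
  by (simp add: twice_differentiable_at_def hessian_def)

lemma gradient_expansion:
  assumes "e > 0"
  obtains r where "r > 0" "\<And>d. norm d < r \<Longrightarrow>
     norm (gradient \<phi> (x + d) - gradient \<phi> x - hessian \<phi> x *v d) \<le> e * norm d"
proof -
  obtain r where "r > 0" "\<And>y. norm (y - x) < r \<Longrightarrow>
     norm (gradient \<phi> y - gradient \<phi> x - hessian \<phi> x *v (y - x)) \<le> e * norm (y - x)"
    using gradient_has_derivative assms unfolding has_derivative_at_alt by blast
  from this(1) this(2)[of "x + _"] show ?thesis by (intro that[of r]) auto
qed

text \<open>Second derivatives exist at \<open>x\<close> only, so one of the two points compared has
  to be \<open>x\<close> itself. The expansion with \<open>e = 1\<close> suffices.\<close>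

lemma gradient_locally_lipschitz:
  obtains r K where "r > 0" "K \<ge> 0" "\<And>d. norm d < r \<Longrightarrow> norm (gradient \<phi> (x + d) - gradient \<phi> x) \<le> K * norm d"
proof -
  obtain r where r: "r > 0" "\<And>d. norm d < r \<Longrightarrow>
     norm (gradient \<phi> (x + d) - gradient \<phi> x - hessian \<phi> x *v d) \<le> 1 * norm d"
    using gradient_expansion[of 1] by auto
  obtain B where B: "B > 0" "\<And>d. norm (hessian \<phi> x *v d) \<le> norm d * B"
    using bounded_linear.pos_bounded[OF matrix_vector_mul_bounded_linear] by blast
  show ?thesis
  proof (rule that[of r "1 + B"])
    fix d :: "real ^ 'n" assume "norm d < r"
    then show "norm (gradient \<phi> (x + d) - gradient \<phi> x) \<le> (1 + B) * norm d"
      using r(2)[of d] B(2)[of d]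
        norm_triangle_ineq2[of "gradient \<phi> (x + d) - gradient \<phi> x" "hessian \<phi> x *v d"]
      by (simp add: algebra_simps)
  qed (use r B in auto)
qed

lemma gradient_diff_inner_expansion:
  assumes "e > 0"
  obtains r where "r > 0" "\<And>d. norm d < r \<Longrightarrow>
    \<bar>(gradient \<phi> (x + d) - gradient \<phi> x) \<bullet> d - d \<bullet> (hessian \<phi> x *v d)\<bar> \<le> e * (norm d)\<^sup>2"
proof -
  obtain r where r: "r > 0" "\<And>d. norm d < r \<Longrightarrow>
     norm (gradient \<phi> (x + d) - gradient \<phi> x - hessian \<phi> x *v d) \<le> e * norm d"
    using gradient_expansion[OF assms] by auto
  show ?thesis
  proof (rule that[OF r(1)])
    fix d :: "real ^ 'n" assume "norm d < r"
    from mult_right_mono[OF r(2)[OF this] norm_ge_zero[of d]]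
    show "\<bar>(gradient \<phi> (x + d) - gradient \<phi> x) \<bullet> d - d \<bullet> (hessian \<phi> x *v d)\<bar> \<le> e * (norm d)\<^sup>2"
      using Cauchy_Schwarz_ineq2[of "gradient \<phi> (x + d) - gradient \<phi> x - hessian \<phi> x *v d" d]
      by (simp add: inner_diff_left inner_diff_right inner_commute power2_eq_square mult.assoc)
  qed
qed

text \<open>The midpoint bound needs the gradient only at \<open>x\<close> and at
  \<open>x + d/2\<close>; the expansion there scales both the Hessian form and the error by
  1/4.\<close>

lemma bregman_expansion:
  assumes "e > 0"
  obtains r where "r > 0" "\<And>d. norm d < r \<Longrightarrow>
    bregman \<phi> x (x + d) \<ge> 1/4 * (d \<bullet> (hessian \<phi> x *v d)) - e * (norm d)\<^sup>2"
proof -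
  obtain r where r: "r > 0" "\<And>d. norm d < r \<Longrightarrow>
    \<bar>(gradient \<phi> (x + d) - gradient \<phi> x) \<bullet> d - d \<bullet> (hessian \<phi> x *v d)\<bar> \<le> e * (norm d)\<^sup>2"
    using gradient_diff_inner_expansion[OF assms] by auto
  show ?thesis
  proof (rule that[OF r(1)])
    fix d :: "real ^ 'n" assume d: "norm d < r"
    have "\<bar>(gradient \<phi> (x + (1/2) *\<^sub>R d) - gradient \<phi> x) \<bullet> ((1/2) *\<^sub>R d) - 1/4 * (d \<bullet> (hessian \<phi> x *v d))\<bar>
        \<le> 1/4 * (e * (norm d)\<^sup>2)"
      using r(2)[of "(1/2) *\<^sub>R d"] d norm_ge_zero[of d] by (simp add: matrix_vector_mult_scaleR power_divide)
    moreover have "e * (norm d)\<^sup>2 \<ge> 0" using assms by simp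
    ultimately show "bregman \<phi> x (x + d) \<ge> 1/4 * (d \<bullet> (hessian \<phi> x *v d)) - e * (norm d)\<^sup>2"
      using bregman_ge_half_gradient[of x d] unfolding abs_le_iff by linarith
  qed
qed

text \<open>Rescaling \<open>d\<close> to \<open>s d\<close> turns an error of second order into a multiple of \<open>s\<^sup>2\<close>.\<close>

lemma hessian_psd: "d \<bullet> (hessian \<phi> x *v d) \<ge> 0"
proof (rule field_le_epsilon)
  fix e :: real assume "e > 0"
  \<comment> \<open>The summand 1 keeps the denominator positive when \<open>d = 0\<close>; the same
    device serves for \<open>s\<close> below.\<close>
  define c where "c = e / (1 + (norm d)\<^sup>2)"
  have pos: "1 + (norm d)\<^sup>2 > 0" by (simp add: add_pos_nonneg)
  have c: "c > 0" "c * (norm d)\<^sup>2 \<le> e"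
    using \<open>e > 0\<close> pos by (auto simp: c_def field_simps)
  obtain r where r: "r > 0" "\<And>d. norm d < r \<Longrightarrow>
    \<bar>(gradient \<phi> (x + d) - gradient \<phi> x) \<bullet> d - d \<bullet> (hessian \<phi> x *v d)\<bar> \<le> c * (norm d)\<^sup>2"
    using gradient_diff_inner_expansion[OF c(1)] by auto
  define s where "s = r / (1 + norm d)"
  have s: "s > 0" "norm (s *\<^sub>R d) < r"
    using r(1) by (auto simp: s_def field_simps add_pos_nonneg)
  have "0 \<le> s\<^sup>2 * (d \<bullet> (hessian \<phi> x *v d) + c * (norm d)\<^sup>2)"
    using r(2)[OF s(2)] gradient_monotone[of "x + s *\<^sub>R d" x]
    by (simp add: matrix_vector_mult_scaleR power2_eq_square algebra_simps)
  then have "0 \<le> d \<bullet> (hessian \<phi> x *v d) + c * (norm d)\<^sup>2"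
    using s(1) by (simp add: zero_le_mult_iff)
  with c show "0 \<le> d \<bullet> (hessian \<phi> x *v d) + e" by simp
qed

text \<open>The divergence vanishes at \<open>s *\<^sub>R d\<close> too; inserting this into the
  second-order lower bound and dividing by \<open>s\<^sup>2\<close> leaves only an arbitrarily small
  error. With \<open>hessian_psd\<close> the form is then zero.\<close>

lemma hessian_nonpos_of_bregman_eq_0:
  assumes "bregman \<phi> x (x + d) = 0"
  shows "d \<bullet> (hessian \<phi> x *v d) \<le> 0"
proof (rule field_le_epsilon)
  fix e :: real assume "e > 0"
  define c where "c = e / (4 * (1 + (norm d)\<^sup>2))"
  have pos: "1 + (norm d)\<^sup>2 > 0" by (simp add: add_pos_nonneg)
  have c: "c > 0" "4 * c * (norm d)\<^sup>2 \<le> e"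
    using \<open>e > 0\<close> pos by (auto simp: c_def field_simps)
  obtain r where r: "r > 0" "\<And>d. norm d < r \<Longrightarrow>
    bregman \<phi> x (x + d) \<ge> 1/4 * (d \<bullet> (hessian \<phi> x *v d)) - c * (norm d)\<^sup>2"
    using bregman_expansion[OF c(1)] by auto
  \<comment> \<open>The bound 1 keeps the point on the segment from \<open>x\<close> to
    \<open>x + d\<close>; the other bound brings it within the radius of the expansion.\<close>
  define s where "s = min 1 (r / (1 + norm d))"
  have s: "s > 0" "s \<le> 1" "norm (s *\<^sub>R d) < r"
  proof -
    have "r / (1 + norm d) * norm d < r" using r(1) by (auto simp: field_simps add_pos_nonneg)
    moreover have "s * norm d \<le> r / (1 + norm d) * norm d" by (intro mult_right_mono) (auto simp: s_def)
    moreover show "s > 0" "s \<le> 1" using r(1) by (auto simp: s_def add_pos_nonneg)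
    ultimately show "norm (s *\<^sub>R d) < r" by simp
  qed
  have "bregman \<phi> x (x + s *\<^sub>R d) \<le> 0"
    using bregman_along_line_le[of s x d] s(1,2) assms by simp
  with r(2)[OF s(3)] have "1/4 * (s *\<^sub>R d \<bullet> (hessian \<phi> x *v (s *\<^sub>R d))) - c * (norm (s *\<^sub>R d))\<^sup>2 \<le> 0"
    by linarith
  then have "s\<^sup>2 * (1/4 * (d \<bullet> (hessian \<phi> x *v d)) - c * (norm d)\<^sup>2) \<le> 0"
    by (simp add: matrix_vector_mult_scaleR power_mult_distrib)
      (simp add: power2_eq_square right_diff_distrib mult.assoc mult.left_commute)
  then have "1/4 * (d \<bullet> (hessian \<phi> x *v d)) - c * (norm d)\<^sup>2 \<le> 0"
    using s(1) by (simp add: mult_le_0_iff)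
  with c show "d \<bullet> (hessian \<phi> x *v d) \<le> 0 + e" by simp
qed

end

end

lemma continuously_differentiable_imp_continuous:
  "continuously_differentiable \<phi> \<Longrightarrow> continuous_on UNIV \<phi>"
  by (simp add: continuously_differentiable_def continuous_at_imp_continuous_on
      differentiable_imp_continuous_within)

text \<open>The rows of the Jacobian are the component gradients. The sum form lets active and
  inactive constraints be treated separately.\<close>

lemma transpose_jacobian_vec:
  fixes g :: "real ^ 'n \<Rightarrow> real ^ 'm"
  assumes "\<And>i. (\<lambda>y. g y $ i) differentiable (at x)"
  shows "transpose (jacobian g (at x)) *v \<xi> = (\<Sum>i\<in>UNIV. \<xi> $ i *\<^sub>R gradient (\<lambda>y. g y $ i) x)"
proof -
  have "g differentiable (at x)"
    using assms by (subst differentiable_componentwise_within[where S = UNIV, simplified])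
      (auto simp: Basis_vec_def inner_axis)
  then have D: "(g has_derivative (\<lambda>h. jacobian g (at x) *v h)) (at x)"
    by (simp add: jacobian_works)
  have "frechet_derivative (\<lambda>y. g y $ i) (at x) = (\<lambda>h. (jacobian g (at x) *v h) $ i)" for i
    using bounded_linear.has_derivative[OF bounded_linear_vec_nth D]
    by (rule frechet_derivative_at[symmetric])
  then have "gradient (\<lambda>y. g y $ i) x = jacobian g (at x) $ i" for i
    by (simp add: gradient_def vec_eq_iff matrix_vector_mult_basis column_def)
  then show ?thesis
    by (simp add: vec_eq_iff matrix_vector_mult_def transpose_def mult.commute)
qed

section \<open>Local expansions as eventual bounds, so that finitely many can be intersected\<close>

lemma bregman_eventually_ge:
  assumes "convex_on UNIV \<phi>" "continuously_differentiable \<phi>" "twice_differentiable_at \<phi> x" "e > 0"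
  shows "\<forall>\<^sub>F y in nhds x.
    bregman \<phi> x y \<ge> 1/4 * ((y - x) \<bullet> (hessian \<phi> x *v (y - x))) - e * (norm (y - x))\<^sup>2"
proof -
  obtain r where "r > 0" "\<And>d. norm d < r \<Longrightarrow>
      bregman \<phi> x (x + d) \<ge> 1/4 * (d \<bullet> (hessian \<phi> x *v d)) - e * (norm d)\<^sup>2"
    using bregman_expansion[OF assms] by blast
  then show ?thesis by (intro eventually_nhds_radius[of r]) simp_all
qed

lemma scalar_eventually_le:
  assumes "\<phi> differentiable (at x)" "e > 0"
  shows "\<forall>\<^sub>F y in nhds x. \<bar>\<phi> y - \<phi> x - gradient \<phi> x \<bullet> (y - x)\<bar> \<le> e * norm (y - x)"
proof -
  have "(\<phi> has_derivative (\<lambda>h. h \<bullet> gradient \<phi> x)) (at x)"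
    using gderiv_gradient[OF assms(1)] by (simp add: gderiv_def)
  then obtain r where "r > 0" "\<And>y. norm (y - x) < r \<Longrightarrow>
     norm (\<phi> y - \<phi> x - (y - x) \<bullet> gradient \<phi> x) \<le> e * norm (y - x)"
    using assms unfolding has_derivative_at_alt by blast
  from this(1) this(2)[of "x + _"] show ?thesis
    by (intro eventually_nhds_radius[of r]) (simp_all add: inner_commute)
qed

lemma gradient_eventually_lipschitz:
  assumes "convex_on UNIV \<phi>" "continuously_differentiable \<phi>" "twice_differentiable_at \<phi> x"
  shows "\<exists>K\<ge>0. \<forall>\<^sub>F y in nhds x. norm (gradient \<phi> y - gradient \<phi> x) \<le> K * norm (y - x)"
proof -
  obtain r K where "r > 0" "K \<ge> 0"
      "\<And>d. norm d < r \<Longrightarrow> norm (gradient \<phi> (x + d) - gradient \<phi> x) \<le> K * norm d"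
    using gradient_locally_lipschitz[OF assms] by blast
  then show ?thesis by (intro exI[of _ K] conjI eventually_nhds_radius[of r]) simp_all
qed

lemma scalar_eventually_lipschitz:
  fixes \<phi> :: "real ^ 'n \<Rightarrow> real"
  assumes "\<phi> differentiable (at x)"
  shows "\<exists>K\<ge>0. \<forall>\<^sub>F y in nhds x. \<bar>\<phi> y - \<phi> x\<bar> \<le> K * norm (y - x)"
proof (intro exI conjI)
  show "1 + norm (gradient \<phi> x) \<ge> 0" by simp
  show "\<forall>\<^sub>F y in nhds x. \<bar>\<phi> y - \<phi> x\<bar> \<le> (1 + norm (gradient \<phi> x)) * norm (y - x)"
    using scalar_eventually_le[OF assms zero_less_one]
  proof eventually_elim
    case (elim y)
    then show ?case
      using Cauchy_Schwarz_ineq2[of "gradient \<phi> x" "y - x"] by (simp add: algebra_simps)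
  qed
qed

section \<open>Regular KKT points and the dissipation\<close>

declare transpose_matrix_vector [simp del]

locale regular_kkt =
  fixes f :: "real ^ 'n \<Rightarrow> real"
    and g :: "real ^ 'n \<Rightarrow> real ^ 'm"
    and A :: "real ^ 'n ^ 'p"
    and b :: "real ^ 'p"
    and xs :: "real ^ 'n" and ns :: "real ^ 'p" and ls :: "real ^ 'm"
  assumes conv_f: "convex_on UNIV f"
    and C1_f: "continuously_differentiable f"
    and conv_g: "\<And>i. convex_on UNIV (\<lambda>x. g x $ i)"
    and C1_g: "\<And>i. continuously_differentiable (\<lambda>x. g x $ i)"
    and kkt: "kkt_point f A b g (xs, ns, ls)"
    and twice_f: "twice_differentiable_at f xs"
    and twice_g: "\<And>i. twice_differentiable_at (\<lambda>x. g x $ i) xs"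
    and strict: "strict_complementarity g xs ls"
    and licq: "licq A g xs"
    and sosc: "sosc f A g xs ls"
begin

abbreviation dg :: "'m \<Rightarrow> real ^ 'n \<Rightarrow> real ^ 'n" where
  "dg i \<equiv> gradient (\<lambda>y. g y $ i)"

abbreviation act :: "'m set" where "act \<equiv> active_set g xs"

lemma jacobian_term: "transpose (jacobian g (at x)) *v l = (\<Sum>i\<in>UNIV. l $ i *\<^sub>R dg i x)"
  using C1_g by (intro transpose_jacobian_vec) (auto simp: continuously_differentiable_def)

lemma stationary: "gradient f xs + transpose A *v ns + (\<Sum>i\<in>UNIV. ls $ i *\<^sub>R dg i xs) = 0"
  using kkt by (simp add: kkt_point_def jacobian_term)

lemma feasible: "A *v xs = b" "g xs $ i \<le> 0" "ls $ i \<ge> 0" "ls $ i * g xs $ i = 0"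
  using kkt by (auto simp: kkt_point_def)

lemma active: "i \<in> act \<Longrightarrow> g xs $ i = 0" "i \<in> act \<Longrightarrow> ls $ i > 0"
  using strict by (auto simp: active_set_def strict_complementarity_def)

lemma inactive: "i \<notin> act \<Longrightarrow> g xs $ i < 0" "i \<notin> act \<Longrightarrow> ls $ i = 0"
  using feasible(2,4)[of i] by (auto simp: active_set_def)

text \<open>LICQ in terms of coefficients: independence of a set speaks of coefficients attached to
  vectors, and injectivity of the family transfers this to coefficients attached to indices.\<close>

lemma licqD:
  assumes "transpose A *v n + (\<Sum>i\<in>act. l $ i *\<^sub>R dg i xs) = 0"
  shows "n = 0" "i \<in> act \<Longrightarrow> l $ i = 0"
proof -
  define v where "v = case_sum (\<lambda>k. row k A) (\<lambda>i. dg i xs)"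
  define I where "I = (UNIV :: 'p set) <+> act"
  define c where "c = case_sum (\<lambda>k. n $ k) (\<lambda>i. l $ i)"
  have inj: "inj_on v I" and ind: "independent (v ` I)"
    using licq by (simp_all add: licq_def Let_def v_def I_def)
  have "transpose A *v n = (\<Sum>k\<in>UNIV. n $ k *\<^sub>R row k A)"
    by (simp add: matrix_mult_sum column_transpose scalar_mult_eq_scaleR)
  then have "(\<Sum>j\<in>I. c j *\<^sub>R v j) = 0"
    using assms by (simp add: I_def sum.Plus c_def v_def)
  \<comment> \<open>Each vector receives the coefficient of its unique index.\<close>
  then have sum0: "(\<Sum>w\<in>v ` I. c (the_inv_into I v w) *\<^sub>R w) = 0"
    by (simp add: sum.reindex[OF inj] the_inv_into_f_f[OF inj] cong: sum.cong)
  have c0: "c j = 0" if "j \<in> I" for j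
    using independentD[OF ind _ subset_refl sum0, of "v j"] that
    by (simp add: I_def the_inv_into_f_f[OF inj[unfolded I_def]])
  show "n = 0"
    using c0[of "Inl _"] by (auto simp: vec_eq_iff c_def I_def)
  show "l $ i = 0" if "i \<in> act"
    using c0[of "Inr i"] that by (auto simp: c_def I_def)
qed

section \<open>The quadratic form of the Hessian of the Lagrangian\<close>

definition lagr_form :: "real ^ 'n \<Rightarrow> real" where
  "lagr_form d = d \<bullet> (hessian f xs *v d) + (\<Sum>i\<in>UNIV. ls $ i * (d \<bullet> (hessian (\<lambda>y. g y $ i) xs *v d)))"

lemma lagr_form_nonneg: "lagr_form d \<ge> 0"
  unfolding lagr_form_def
  by (intro add_nonneg_nonneg sum_nonneg mult_nonneg_nonneg feasible
      hessian_psd[OF conv_f C1_f twice_f] hessian_psd[OF conv_g C1_g twice_g])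

text \<open>Strict complementarity leaves no active index with zero multiplier, so the critical cone
  in SOSC is the subspace described here.\<close>

lemma lagr_form_pos:
  assumes "d \<noteq> 0" "A *v d = 0" "\<And>i. i \<in> act \<Longrightarrow> dg i xs \<bullet> d = 0"
  shows "lagr_form d > 0"
proof -
  have "d \<bullet> ((hessian f xs + (\<Sum>i\<in>UNIV. ls $ i *\<^sub>R hessian (\<lambda>y. g y $ i) xs)) *v d) > 0"
    by (rule sosc[unfolded sosc_def, THEN spec, THEN mp]) (auto simp: assms dest: active(2))
  moreover have "(\<Sum>i\<in>UNIV. ls $ i *\<^sub>R hessian (\<lambda>y. g y $ i) xs) *v d
      = (\<Sum>i\<in>UNIV. ls $ i *\<^sub>R (hessian (\<lambda>y. g y $ i) xs *v d))"
    by (induction rule: finite_induct[OF finite])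
       (auto simp: matrix_vector_mult_add_rdistrib scaleR_matrix_vector_assoc)
  ultimately show ?thesis
    by (simp add: lagr_form_def matrix_vector_mult_add_rdistrib inner_add_right inner_sum_right)
qed

text \<open>In the nonconvex case the penalties would have to be large. Here convexity makes
  \<open>lagr_form\<close> nonnegative everywhere, so for any positive weights a zero of the sum is
  a zero of each term, and SOSC leaves only \<open>d = 0\<close>.\<close>

lemma augmented_form_ge_norm:
  assumes "\<alpha> > 0" "\<beta> > 0"
  shows "\<exists>w>0. \<forall>d. w * (norm d)\<^sup>2
    \<le> 1/4 * lagr_form d + \<alpha> * (norm (A *v d))\<^sup>2 + \<beta> * (\<Sum>i\<in>act. (dg i xs \<bullet> d)\<^sup>2)"
proof (rule posdef_form_ge_norm)
  let ?q = "\<lambda>d. 1/4 * lagr_form d + \<alpha> * (norm (A *v d))\<^sup>2 + \<beta> * (\<Sum>i\<in>act. (dg i xs \<bullet> d)\<^sup>2)"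
  show "continuous_on UNIV ?q"
    unfolding lagr_form_def
    by (intro continuous_intros matrix_vector_mult_linear_continuous_on)
  show "?q (c *\<^sub>R d) = c\<^sup>2 * ?q d" for c d
    by (simp add: lagr_form_def matrix_vector_mult_scaleR power_mult_distrib algebra_simps
        sum_distrib_left power2_eq_square)
  show "?q d > 0" if "d \<noteq> 0" for d
  proof -
    have nn: "lagr_form d \<ge> 0" "\<alpha> * (norm (A *v d))\<^sup>2 \<ge> 0" "\<beta> * (\<Sum>i\<in>act. (dg i xs \<bullet> d)\<^sup>2) \<ge> 0"
      using assms lagr_form_nonneg by (auto intro!: sum_nonneg mult_nonneg_nonneg)
    show ?thesis
    proof (rule ccontr)
      assume "\<not> ?thesis"
      with nn have z: "lagr_form d = 0" "\<alpha> * (norm (A *v d))\<^sup>2 = 0" "\<beta> * (\<Sum>i\<in>act. (dg i xs \<bullet> d)\<^sup>2) = 0"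
        by linarith+
      with assms have "A *v d = 0" "\<And>i. i \<in> act \<Longrightarrow> dg i xs \<bullet> d = 0"
        by (auto simp: sum_nonneg_eq_0_iff)
      with lagr_form_pos[OF that] z(1) show False by auto
    qed
  qed
qed

end

text \<open>
  The gains \<open>k\<^sub>p\<close> and \<open>k\<^sub>i\<close> of the equality constraints are \<open>kp\<close> and \<open>ki\<close>, those of the inequality
  constraints are \<open>k\<close> and \<open>kl\<close>. \<open>G\<close> is the gradient in \<open>x\<close> of the augmented Lagrangian
  \<open>f(x) + \<nu>\<^sup>T(A x - b) + kp/2 \<parallel>A x - b\<parallel>\<^sup>2 + (\<parallel>u\<parallel>\<^sup>2 - \<parallel>\<xi>\<parallel>\<^sup>2)/(2 k)\<close>, and \<open>W\<close> pairs the saddle operator with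
  the distance to the KKT point.
\<close>

locale sppid_gains = regular_kkt f g A b xs ns ls
  for f :: "real ^ 'n \<Rightarrow> real"
    and g :: "real ^ 'n \<Rightarrow> real ^ 'm"
    and A :: "real ^ 'n ^ 'p"
    and b xs ns ls +
  fixes kp k :: real
  assumes kp_pos: "kp > 0" and k_pos: "k > 0"
begin

definition u :: "real ^ 'n \<Rightarrow> real ^ 'm \<Rightarrow> real ^ 'm" where
  "u x l = ReLU (l + k *\<^sub>R g x)"

definition G :: "real ^ 'n \<Rightarrow> real ^ 'p \<Rightarrow> real ^ 'm \<Rightarrow> real ^ 'n" where
  "G x n l = gradient f x + transpose A *v (n + kp *\<^sub>R (A *v x - b)) + (\<Sum>i\<in>UNIV. u x l $ i *\<^sub>R dg i x)"

definition W :: "real ^ 'n \<Rightarrow> real ^ 'p \<Rightarrow> real ^ 'm \<Rightarrow> real" where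
  "W x n l = G x n l \<bullet> (x - xs) - (A *v x - b) \<bullet> (n - ns) - (u x l - l) \<bullet> (l - ls) / k"

lemma u_nth: "u x l $ i = max (l $ i + k * g x $ i) 0"
  by (simp add: u_def ReLU_def)

lemma u_nonneg: "u x l $ i \<ge> 0" by (simp add: u_nth)

lemma ls_eq_max: "ls $ i = max (ls $ i + k * g xs $ i) 0"
proof (cases "i \<in> act")
  case True
  then show ?thesis using active[OF True] by simp
next
  case False
  then show ?thesis using inactive[OF False] k_pos by (simp add: mult_pos_neg less_imp_le)
qed

lemma inner_transpose_A: "(transpose A *v n) \<bullet> d = n \<bullet> (A *v d)"
  by (metis dot_lmul_matrix vector_transpose_matrix transpose_transpose)

lemma A_diff: "A *v (x - xs) = A *v x - b"
  by (simp add: matrix_vector_mult_diff_distrib feasible)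

text \<open>Subtracting the stationarity condition paired with \<open>x - xs\<close> removes the
  coupling through the equality multipliers.\<close>

lemma W_eq:
  "W x n l = (gradient f x - gradient f xs) \<bullet> (x - xs) + kp * (norm (A *v x - b))\<^sup>2
     + (\<Sum>i\<in>UNIV. u x l $ i * (dg i x \<bullet> (x - xs)) - ls $ i * (dg i xs \<bullet> (x - xs))
          - (u x l $ i - l $ i) * (l $ i - ls $ i) / k)"
proof -
  have "(gradient f xs + transpose A *v ns + (\<Sum>i\<in>UNIV. ls $ i *\<^sub>R dg i xs)) \<bullet> (x - xs) = 0"
    by (simp only: stationary inner_zero_left)
  then have "gradient f xs \<bullet> (x - xs) + ns \<bullet> (A *v x - b) + (\<Sum>i\<in>UNIV. ls $ i * (dg i xs \<bullet> (x - xs))) = 0"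
    by (simp only: inner_add_left inner_transpose_A A_diff inner_sum_left inner_scaleR_left)
  moreover have "G x n l \<bullet> (x - xs) = gradient f x \<bullet> (x - xs) + n \<bullet> (A *v x - b)
      + kp * (norm (A *v x - b))\<^sup>2 + (\<Sum>i\<in>UNIV. u x l $ i * (dg i x \<bullet> (x - xs)))"
    by (simp only: G_def inner_add_left inner_transpose_A A_diff inner_sum_left inner_scaleR_left
        power2_norm_eq_inner)
  moreover have "(u x l - l) \<bullet> (l - ls) / k = (\<Sum>i\<in>UNIV. (u x l $ i - l $ i) * (l $ i - ls $ i) / k)"
    by (simp add: inner_vec_def sum_divide_distrib)
  ultimately show ?thesis
    by (simp add: W_def inner_diff_left inner_diff_right inner_commute[of n] inner_commute[of ns] sum_subtractf)
qed

definition slack :: "real ^ 'n \<Rightarrow> real ^ 'm \<Rightarrow> 'm \<Rightarrow> real" where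
  "slack x l i = (u x l $ i - ls $ i)
     * ((l $ i + k * g x $ i) - (ls $ i + k * g xs $ i) - (u x l $ i - ls $ i))"

text \<open>This is the firm nonexpansiveness of \<open>ReLU\<close>.\<close>

lemma slack_nonneg: "slack x l i \<ge> 0"
proof -
  have "(max p 0 - max q 0) * ((p - q) - (max p 0 - max q 0)) \<ge> 0" for p q :: real
    by (auto simp: max_def mult_nonneg_nonpos mult_nonpos_nonneg)
  from this[of "l $ i + k * g x $ i" "ls $ i + k * g xs $ i"] show ?thesis
    unfolding slack_def u_nth ls_eq_max[symmetric] .
qed

text \<open>Convexity of \<open>g\<close> enters through the tangent at \<open>x\<close>, which may
  be multiplied by \<open>u x l $ i \<ge> 0\<close>; the rest of each summand is an exact identity.
  Every term of the bound is nonnegative, so \<open>W = 0\<close> annihilates each one.\<close>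

lemma W_ge:
  "W x n l \<ge> bregman f xs x + (\<Sum>i\<in>UNIV. ls $ i * bregman (\<lambda>y. g y $ i) xs x)
     + kp * (norm (A *v x - b))\<^sup>2 + (\<Sum>i\<in>UNIV. (u x l $ i - l $ i)\<^sup>2 / k) + (\<Sum>i\<in>UNIV. slack x l i / k)"
proof -
  have "bregman f xs x \<le> (gradient f x - gradient f xs) \<bullet> (x - xs)"
    using convex_ge_tangent[OF conv_f C1_f, of x xs]
    by (simp add: bregman_def inner_diff_left inner_diff_right)
  moreover have "ls $ i * bregman (\<lambda>y. g y $ i) xs x + (u x l $ i - l $ i)\<^sup>2 / k + slack x l i / k
      \<le> u x l $ i * (dg i x \<bullet> (x - xs)) - ls $ i * (dg i xs \<bullet> (x - xs))
          - (u x l $ i - l $ i) * (l $ i - ls $ i) / k" for i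
  proof -
    have "g x $ i - g xs $ i \<le> dg i x \<bullet> (x - xs)"
      using convex_ge_tangent[OF conv_g C1_g, of x i xs] by (simp add: inner_diff_right)
    from mult_left_mono[OF this u_nonneg[of x l i]]
    have "u x l $ i * (g x $ i - g xs $ i) \<le> u x l $ i * (dg i x \<bullet> (x - xs))" .
    moreover have "ls $ i * bregman (\<lambda>y. g y $ i) xs x + (u x l $ i - l $ i)\<^sup>2 / k + slack x l i / k
      = u x l $ i * (g x $ i - g xs $ i) - ls $ i * (dg i xs \<bullet> (x - xs))
          - (u x l $ i - l $ i) * (l $ i - ls $ i) / k"
    proof -
      have "(u x l $ i - l $ i)\<^sup>2 + slack x l i
        = k * ((u x l $ i - ls $ i) * (g x $ i - g xs $ i)) - (u x l $ i - l $ i) * (l $ i - ls $ i)"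
        by (simp add: slack_def power2_eq_square algebra_simps)
      then have "(u x l $ i - l $ i)\<^sup>2 / k + slack x l i / k
        = (u x l $ i - ls $ i) * (g x $ i - g xs $ i) - (u x l $ i - l $ i) * (l $ i - ls $ i) / k"
        using k_pos by (simp add: diff_divide_distrib flip: add_divide_distrib)
      then show ?thesis by (simp add: bregman_def algebra_simps)
    qed
    ultimately show ?thesis by simp
  qed
  then have "(\<Sum>i\<in>UNIV. ls $ i * bregman (\<lambda>y. g y $ i) xs x + (u x l $ i - l $ i)\<^sup>2 / k + slack x l i / k)
     \<le> (\<Sum>i\<in>UNIV. u x l $ i * (dg i x \<bullet> (x - xs)) - ls $ i * (dg i xs \<bullet> (x - xs))
          - (u x l $ i - l $ i) * (l $ i - ls $ i) / k)"
    by (rule sum_mono)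
  ultimately show ?thesis
    unfolding W_eq by (simp add: sum.distrib)
qed

lemma W_terms_nonneg:
  "bregman f xs x \<ge> 0" "(\<Sum>i\<in>UNIV. ls $ i * bregman (\<lambda>y. g y $ i) xs x) \<ge> 0"
  "kp * (norm (A *v x - b))\<^sup>2 \<ge> 0" "(\<Sum>i\<in>UNIV. (u x l $ i - l $ i)\<^sup>2 / k) \<ge> 0"
  "(\<Sum>i\<in>UNIV. slack x l i / k) \<ge> 0"
  using kp_pos k_pos
  by (auto intro!: sum_nonneg mult_nonneg_nonneg divide_nonneg_nonneg slack_nonneg feasible(3)
      bregman_nonneg conv_f C1_f conv_g C1_g)

lemma W_nonneg: "W x n l \<ge> 0"
  using W_ge[of x l n] W_terms_nonneg(1-3)[of x] W_terms_nonneg(4,5)[of x l] by linarith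

text \<open>When all terms of \<open>W_ge\<close> vanish, \<open>x - xs\<close> lies in the tangent
  space of the active constraints while the Hessian forms along it are nonpositive wherever they
  carry weight. This contradicts \<open>lagr_form_pos\<close> unless \<open>x = xs\<close>.\<close>

lemma W_eq_0D:
  assumes "W x n l = 0"
  shows "x = xs" "u x l = l"
proof -
  have z: "bregman f xs x = 0" "(\<Sum>i\<in>UNIV. ls $ i * bregman (\<lambda>y. g y $ i) xs x) = 0"
  "kp * (norm (A *v x - b))\<^sup>2 = 0" "(\<Sum>i\<in>UNIV. (u x l $ i - l $ i)\<^sup>2 / k) = 0"
  "(\<Sum>i\<in>UNIV. slack x l i / k) = 0"
    using W_ge[of x l n] W_terms_nonneg(1-3)[of x] W_terms_nonneg(4,5)[of x l] assms by linarith+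
  have bg: "ls $ i * bregman (\<lambda>y. g y $ i) xs x = 0" for i
    using z(2) by (subst (asm) sum_nonneg_eq_0_iff)
      (auto intro!: mult_nonneg_nonneg feasible bregman_nonneg conv_g C1_g)
  have ul: "u x l $ i = l $ i" for i
    using z(4) k_pos by (subst (asm) sum_nonneg_eq_0_iff) auto
  then show "u x l = l" by (simp add: vec_eq_iff)
  have sl: "slack x l i = 0" for i
    using z(5) k_pos by (subst (asm) sum_nonneg_eq_0_iff) (auto intro!: divide_nonneg_nonneg slack_nonneg)
  show "x = xs"
  proof (rule ccontr)
    define d where "d = x - xs"
    have x: "x = xs + d" by (simp add: d_def)
    assume "x \<noteq> xs"
    then have "d \<noteq> 0" by (simp add: d_def)
    moreover have "A *v d = 0" using z(3) kp_pos by (simp add: d_def A_diff)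
    moreover have "dg i xs \<bullet> d = 0" if i: "i \<in> act" for i
    proof -
      \<comment> \<open>With \<open>u = l\<close> and \<open>g xs $ i = 0\<close> the slack is
        \<open>(l $ i - ls $ i) * (k * g x $ i)\<close>. If its first factor vanishes, then
        \<open>l $ i > 0\<close>, so the ReLU is on its linear branch and \<open>u = l\<close> again
        gives zero.\<close>
      have "g x $ i = 0"
      proof -
        have "(l $ i - ls $ i) * (k * g x $ i) = 0"
          using sl[of i] ul[of i] active[OF i] by (simp add: slack_def)
        then consider "g x $ i = 0" | "l $ i = ls $ i" using k_pos by auto
        then show ?thesis
        proof cases
          case 2
          with active(2)[OF i] ul[of i] have "l $ i + k * g x $ i = l $ i"
            by (simp add: u_nth max_def split: if_splits)
          with k_pos show ?thesis by simp
        qed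
      qed
      then show ?thesis using bg[of i] active[OF i] by (simp add: bregman_def d_def)
    qed
    ultimately have "lagr_form d > 0" by (rule lagr_form_pos)
    moreover have "ls $ i * (d \<bullet> (hessian (\<lambda>y. g y $ i) xs *v d)) \<le> 0" for i
      using bg[of i] hessian_nonpos_of_bregman_eq_0[OF conv_g C1_g twice_g, of i d] feasible(3)[of i] x
      by (auto simp: mult_le_0_iff)
    then have "lagr_form d \<le> 0"
      using hessian_nonpos_of_bregman_eq_0[OF conv_f C1_f twice_f, of d] z(1) x
      by (auto simp: lagr_form_def intro!: add_nonpos_nonpos sum_nonpos)
    ultimately show False by simp
  qed
qed

text \<open>Once \<open>x = xs\<close> and \<open>u = l\<close>, the inactive multipliers vanish and
  \<open>G = 0\<close> is stationarity at \<open>xs\<close>; subtracting the two stationarity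
  equations leaves a combination that LICQ makes trivial.\<close>

lemma equilibrium_unique:
  assumes W0: "W x n l = 0" and G0: "G x n l = 0"
  shows "x = xs" "n = ns" "l = ls"
proof -
  note W0 = W_eq_0D[OF W0]
  show "x = xs" by (fact W0)
  with W0 have ul: "u xs l = l" by simp
  \<comment> \<open>The equation \<open>l $ i = max (l $ i + k * g xs $ i) 0\<close> with
    \<open>g xs $ i < 0\<close> rules out the positive branch.\<close>
  have l0: "l $ i = 0" if "i \<notin> act" for i
    using arg_cong[OF ul, of "\<lambda>v. v $ i"] inactive[OF that] k_pos mult_pos_neg[of k "g xs $ i"]
    by (auto simp: u_nth max_def split: if_splits)
  have "gradient f xs + transpose A *v n + (\<Sum>i\<in>UNIV. l $ i *\<^sub>R dg i xs) = 0"
    using G0 \<open>x = xs\<close> by (simp add: G_def ul feasible(1))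
  moreover have "transpose A *v n - transpose A *v ns
     + ((\<Sum>i\<in>UNIV. l $ i *\<^sub>R dg i xs) - (\<Sum>i\<in>UNIV. ls $ i *\<^sub>R dg i xs))
     = (gradient f xs + transpose A *v n + (\<Sum>i\<in>UNIV. l $ i *\<^sub>R dg i xs))
     - (gradient f xs + transpose A *v ns + (\<Sum>i\<in>UNIV. ls $ i *\<^sub>R dg i xs))"
    by simp
  ultimately have "transpose A *v n - transpose A *v ns
     + ((\<Sum>i\<in>UNIV. l $ i *\<^sub>R dg i xs) - (\<Sum>i\<in>UNIV. ls $ i *\<^sub>R dg i xs)) = 0"
    by (simp only: stationary diff_self)
  then have "transpose A *v (n - ns) + (\<Sum>i\<in>UNIV. (l - ls) $ i *\<^sub>R dg i xs) = 0"
    by (simp add: matrix_vector_mult_diff_distrib scaleR_diff_left sum_subtractf)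
  moreover have "(\<Sum>i\<in>UNIV. (l - ls) $ i *\<^sub>R dg i xs) = (\<Sum>i\<in>act. (l - ls) $ i *\<^sub>R dg i xs)"
    by (rule sum.mono_neutral_right) (auto simp: l0 inactive)
  ultimately have 0: "transpose A *v (n - ns) + (\<Sum>i\<in>act. (l - ls) $ i *\<^sub>R dg i xs) = 0" by simp
  show "n = ns" using licqD(1)[OF 0] by simp
  show "l = ls"
    using licqD(2)[OF 0] l0 inactive by (auto simp: vec_eq_iff) (metis eq_iff_diff_eq_0)
qed

text \<open>Any KKT point satisfies \<open>u x l = l\<close>, which makes it a common zero of
  \<open>G\<close> and \<open>W\<close>.\<close>

lemma kkt_point_unique:
  assumes "kkt_point f A b g (x, n, l)"
  shows "(x, n, l) = (xs, ns, ls)"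
proof -
  have x: "gradient f x + transpose A *v n + (\<Sum>i\<in>UNIV. l $ i *\<^sub>R dg i x) = 0" "A *v x = b"
    "\<And>i. g x $ i \<le> 0" "\<And>i. l $ i \<ge> 0" "\<And>i. l $ i * g x $ i = 0"
    using assms by (auto simp add: kkt_point_def jacobian_term)
  have "u x l $ i = l $ i" for i
    using x(3)[of i] x(4)[of i] x(5)[of i] k_pos by (auto simp: u_nth max_def mult_le_0_iff)
  then have "u x l = l" by (simp add: vec_eq_iff)
  then have "G x n l = 0" "W x n l = 0" using x by (auto simp: G_def W_def)
  then show ?thesis using equilibrium_unique by blast
qed

section \<open>Continuity of the gradients, of the field and of the dissipation\<close>

lemma continuous_gradients: "continuous_on UNIV (gradient f)" "continuous_on UNIV (dg i)"
  using C1_f C1_g by (auto simp: continuously_differentiable_def)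

lemma continuous_u: "continuous_on UNIV (\<lambda>z. u (fst z) (snd (snd z)))"
proof -
  have "continuous_on UNIV (\<lambda>x. \<chi> i. g x $ i)"
    by (intro continuous_on_vec_lambda continuously_differentiable_imp_continuous[OF C1_g])
  then have cont: "continuous_on UNIV g" by simp
  show ?thesis
    unfolding u_def ReLU_def
    by (intro continuous_intros continuous_on_compose2[OF cont]) auto
qed

lemma continuous_G: "continuous_on UNIV (\<lambda>z. G (fst z) (fst (snd z)) (snd (snd z)))"
  unfolding G_def
  by (intro continuous_intros continuous_u
      continuous_on_compose2[OF continuous_gradients(1)] continuous_on_compose2[OF continuous_gradients(2)]
      continuous_on_compose2[OF matrix_vector_mult_linear_continuous_on[of UNIV]]) auto

lemma continuous_W: "continuous_on UNIV (\<lambda>z. W (fst z) (fst (snd z)) (snd (snd z)))"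
  unfolding W_def using k_pos
  by (intro continuous_intros continuous_G continuous_u
      continuous_on_compose2[OF matrix_vector_mult_linear_continuous_on[of UNIV]]) auto

subsection \<open>Estimates near the KKT point\<close>

abbreviation zs :: "(real ^ 'n) \<times> (real ^ 'p) \<times> (real ^ 'm)" where "zs \<equiv> (xs, ns, ls)"

text \<open>The vector \<open>c\<close> of the overview: the part of \<open>G\<close> that is linear
  in the multiplier errors, with the gradients frozen at \<open>xs\<close>.\<close>

definition lin :: "real ^ 'p \<Rightarrow> real ^ 'm \<Rightarrow> real ^ 'n" where
  "lin n l = transpose A *v (n - ns) + (\<Sum>i\<in>act. (l - ls) $ i *\<^sub>R dg i xs)"

text \<open>By LICQ the linear map \<open>T\<close>, which sends the multiplier errors to
  \<open>lin\<close> and the inactive components, is injective, hence bounded below in finite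
  dimension.\<close>

lemma lin_coercive:
  "\<exists>\<kappa>>0. \<forall>n l. \<kappa> * ((norm (n - ns))\<^sup>2 + (norm (l - ls))\<^sup>2)
     \<le> (norm (lin n l))\<^sup>2 + (\<Sum>i\<in>-act. (l $ i)\<^sup>2)"
proof -
  define T :: "(real ^ 'p) \<times> (real ^ 'm) \<Rightarrow> (real ^ 'n) \<times> (real ^ 'm)" where
    "T = (\<lambda>v. (transpose A *v fst v + (\<Sum>i\<in>act. snd v $ i *\<^sub>R dg i xs),
               \<chi> i. if i \<in> act then 0 else snd v $ i))"
  have "linear T"
    by (rule linearI)
       (auto simp: T_def matrix_vector_right_distrib matrix_vector_mult_scaleR scaleR_add_left sum.distrib
          scaleR_sum_right scaleR_add_right vec_eq_iff)
  moreover have "inj T"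
  proof (subst linear_injective_0[OF \<open>linear T\<close>], intro allI impI)
    fix v assume v: "T v = 0"
    then have 1: "transpose A *v fst v + (\<Sum>i\<in>act. snd v $ i *\<^sub>R dg i xs) = 0"
      and "(\<chi> i. if i \<in> act then 0 else snd v $ i) = 0"
      by (simp_all add: T_def zero_prod_def)
    then have 2: "\<And>i. i \<notin> act \<Longrightarrow> snd v $ i = 0"
      by (simp add: vec_eq_iff) meson
    show "v = 0"
      using licqD[OF 1] 2 by (auto simp: prod_eq_iff vec_eq_iff)
  qed
  ultimately obtain B where B: "B > 0" "\<And>v. B * norm v \<le> norm (T v)"
    by (rule linear_inj_bounded_below_pos) blast
  have "B\<^sup>2 * ((norm (n - ns))\<^sup>2 + (norm (l - ls))\<^sup>2) \<le> (norm (lin n l))\<^sup>2 + (\<Sum>i\<in>-act. (l $ i)\<^sup>2)" for n l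
  proof -
    have "(B * norm (n - ns, l - ls))\<^sup>2 \<le> (norm (T (n - ns, l - ls)))\<^sup>2"
      using B by (intro power_mono) auto
    moreover have "T (n - ns, l - ls) = (lin n l, \<chi> i. if i \<in> act then 0 else (l - ls) $ i)"
      by (simp add: T_def lin_def cong: if_cong)
    then have "(norm (T (n - ns, l - ls)))\<^sup>2
       = (norm (lin n l))\<^sup>2 + (\<Sum>i\<in>UNIV. (if i \<in> act then 0 else (l - ls) $ i)\<^sup>2)"
      by (simp add: norm_Pair norm_sq_vec[of "vec_lambda _"] sum_nonneg)
    moreover have "(\<Sum>i\<in>UNIV. (if i \<in> act then 0 else (l - ls) $ i)\<^sup>2) = (\<Sum>i\<in>-act. (l $ i)\<^sup>2)"
      by (rule sum.mono_neutral_cong_right) (auto simp: inactive)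
    ultimately show ?thesis by (simp add: power_mult_distrib norm_Pair)
  qed
  then show ?thesis using B(1) by (intro exI[of _ "B\<^sup>2"]) auto
qed

lemma continuous_g: "continuous_on UNIV (\<lambda>z :: _ \<times> 'z::topological_space. g (fst z) $ i)"
  by (rule continuous_on_compose2[OF continuously_differentiable_imp_continuous[OF C1_g]])
     (auto intro!: continuous_intros)

text \<open>At the KKT point the argument of the ReLU is \<open>ls $ i > 0\<close> for active
  \<open>i\<close> and \<open>k * g xs $ i < 0\<close> for inactive \<open>i\<close>; continuity
  preserves these signs nearby.\<close>

lemma u_local:
  "\<forall>\<^sub>F z in nhds zs. \<forall>i. u (fst z) (snd (snd z)) $ i
     = (if i \<in> act then snd (snd z) $ i + k * g (fst z) $ i else 0)"
proof (rule eventually_all_finite)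
  fix i
  show "\<forall>\<^sub>F z in nhds zs. u (fst z) (snd (snd z)) $ i
     = (if i \<in> act then snd (snd z) $ i + k * g (fst z) $ i else 0)"
  proof (cases "i \<in> act")
    case True
    have "\<forall>\<^sub>F z in nhds zs. snd (snd z) $ i + k * g (fst z) $ i > 0"
      by (rule eventually_nhds_pos)
         (use active[OF True] in \<open>auto intro!: continuous_on_add continuous_on_mult_left continuous_g continuous_intros\<close>)
    then show ?thesis by eventually_elim (use True in \<open>auto simp: u_nth\<close>)
  next
    case False
    have "\<forall>\<^sub>F z in nhds zs. - (snd (snd z) $ i + k * g (fst z) $ i) > 0"
      by (rule eventually_nhds_pos)
         (use inactive[OF False] k_pos in \<open>auto intro!: continuous_on_minus continuous_on_add continuous_on_mult_left continuous_g
           mult_pos_neg continuous_intros\<close>)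
    then show ?thesis by eventually_elim (use False in \<open>auto simp: u_nth\<close>)
  qed
qed

lemma g_differentiable: "(\<lambda>y. g y $ i) differentiable (at x)"
  using C1_g by (auto simp: continuously_differentiable_def)

text \<open>In \<open>W_ge\<close>, the divergences give the Lagrangian form, the active residuals
  \<open>u - l = k g\<close> give the squares \<open>(dg i xs \<bullet> d)\<^sup>2\<close>, and the
  inactive residuals are \<open>- l\<close>. Up to small errors,
  \<open>augmented_form_ge_norm\<close> bounds the first two together with the equality
  term.\<close>

lemma W_local:
  "\<exists>w>0. \<forall>\<^sub>F z in nhds zs.
     w * ((norm (fst z - xs))\<^sup>2 + (\<Sum>i\<in>-act. (snd (snd z) $ i)\<^sup>2)) \<le> W (fst z) (fst (snd z)) (snd (snd z))"
proof -
  obtain w0 where w0: "w0 > 0" "\<And>d. w0 * (norm d)\<^sup>2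
    \<le> 1/4 * lagr_form d + kp * (norm (A *v d))\<^sup>2 + k/2 * (\<Sum>i\<in>act. (dg i xs \<bullet> d)\<^sup>2)"
    using augmented_form_ge_norm[of kp "k/2"] kp_pos k_pos by auto
  \<comment> \<open>\<open>D\<close> counts the errors \<open>e * (norm d)\<^sup>2\<close>: one from
    \<open>f\<close>, \<open>ls $ i\<close> from each constraint and \<open>k\<close> from each
    active square. The choice of \<open>e\<close> keeps their total below half of
    \<open>w0\<close>.\<close>
  define D where "D = 1 + (\<Sum>i\<in>UNIV. ls $ i) + k * card act"
  have D: "D > 0" using k_pos feasible(3) by (auto simp: D_def intro!: add_pos_nonneg sum_nonneg)
  define e where "e = min 1 (w0 / (2 * D))"
  have e: "e > 0" "e * D \<le> w0 / 2" "e\<^sup>2 \<le> e"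
  proof -
    show "e > 0" using w0(1) D by (simp add: e_def)
    have "e * D \<le> w0 / (2 * D) * D" using D by (intro mult_right_mono) (auto simp: e_def)
    then show "e * D \<le> w0 / 2" using D by simp
    have "e \<le> 1" by (simp add: e_def)
    with \<open>e > 0\<close> show "e\<^sup>2 \<le> e" by (simp add: power2_eq_square mult_left_le)
  qed
  have ev: "\<forall>\<^sub>F x in nhds xs.
      bregman f xs x \<ge> 1/4 * ((x - xs) \<bullet> (hessian f xs *v (x - xs))) - e * (norm (x - xs))\<^sup>2 \<and>
      (\<forall>i. bregman (\<lambda>y. g y $ i) xs x
          \<ge> 1/4 * ((x - xs) \<bullet> (hessian (\<lambda>y. g y $ i) xs *v (x - xs))) - e * (norm (x - xs))\<^sup>2) \<and>
      (\<forall>i. \<bar>g x $ i - g xs $ i - dg i xs \<bullet> (x - xs)\<bar> \<le> e * norm (x - xs))"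
    by (intro eventually_conj eventually_all_finite bregman_eventually_ge scalar_eventually_le
        conv_f C1_f twice_f conv_g C1_g twice_g g_differentiable e)
  define w where "w = min (w0 / 2) (1 / k)"
  have "w > 0" using w0 k_pos by (simp add: w_def)
  moreover have "\<forall>\<^sub>F z in nhds zs.
     w * ((norm (fst z - xs))\<^sup>2 + (\<Sum>i\<in>-act. (snd (snd z) $ i)\<^sup>2)) \<le> W (fst z) (fst (snd z)) (snd (snd z))"
    using eventually_nhds_fst[OF ev] u_local
  proof eventually_elim
    case (elim z)
    define x where "x = fst z"
    define n where "n = fst (snd z)"
    define l where "l = snd (snd z)"
    define d where "d = x - xs"
    have bf: "bregman f xs x \<ge> 1/4 * (d \<bullet> (hessian f xs *v d)) - e * (norm d)\<^sup>2"
      and bg: "\<And>i. bregman (\<lambda>y. g y $ i) xs x \<ge> 1/4 * (d \<bullet> (hessian (\<lambda>y. g y $ i) xs *v d)) - e * (norm d)\<^sup>2"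
      and gl: "\<And>i. \<bar>g x $ i - g xs $ i - dg i xs \<bullet> d\<bar> \<le> e * norm d"
      and ul: "\<And>i. u x l $ i = (if i \<in> act then l $ i + k * g x $ i else 0)"
      using elim by (auto simp: x_def l_def d_def)
    let ?q = "\<lambda>i. d \<bullet> (hessian (\<lambda>y. g y $ i) xs *v d)"
    have "(\<Sum>i\<in>UNIV. ls $ i * bregman (\<lambda>y. g y $ i) xs x)
        \<ge> (\<Sum>i\<in>UNIV. ls $ i * (1/4 * ?q i - e * (norm d)\<^sup>2))"
      by (intro sum_mono mult_left_mono bg feasible)
    also have "(\<Sum>i\<in>UNIV. ls $ i * (1/4 * ?q i - e * (norm d)\<^sup>2))
        = 1/4 * (\<Sum>i\<in>UNIV. ls $ i * ?q i) - (e * (norm d)\<^sup>2) * (\<Sum>i\<in>UNIV. ls $ i)"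
      unfolding sum_distrib_left sum_subtractf[symmetric] by (rule sum.cong) (simp_all add: algebra_simps)
    finally have 1: "(\<Sum>i\<in>UNIV. ls $ i * bregman (\<lambda>y. g y $ i) xs x)
        \<ge> 1/4 * (\<Sum>i\<in>UNIV. ls $ i * ?q i) - (e * (norm d)\<^sup>2) * (\<Sum>i\<in>UNIV. ls $ i)" .
    have sq: "(g x $ i)\<^sup>2 \<ge> 1/2 * (dg i xs \<bullet> d)\<^sup>2 - e * (norm d)\<^sup>2" if "i \<in> act" for i
    proof -
      define \<eta> where "\<eta> = g x $ i - dg i xs \<bullet> d"
      have "\<bar>\<eta>\<bar> \<le> e * norm d" using gl[of i] active(1)[OF that] by (simp add: \<eta>_def)
      then have "\<eta>\<^sup>2 \<le> (e * norm d)\<^sup>2" by (metis abs_ge_zero power2_abs power_mono)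
      also have "\<dots> \<le> e * (norm d)\<^sup>2" using e(3) by (simp add: power_mult_distrib mult_right_mono)
      finally have "\<eta>\<^sup>2 \<le> e * (norm d)\<^sup>2" .
      \<comment> \<open>Completing the square costs half of the main term and avoids a mixed
        term.\<close>
      moreover have "(g x $ i)\<^sup>2 - 1/2 * (dg i xs \<bullet> d)\<^sup>2 + \<eta>\<^sup>2 = 1/2 * (dg i xs \<bullet> d + 2 * \<eta>)\<^sup>2"
        by (simp add: \<eta>_def power2_eq_square algebra_simps)
      moreover have "1/2 * (dg i xs \<bullet> d + 2 * \<eta>)\<^sup>2 \<ge> 0" by simp
      ultimately show ?thesis by linarith
    qed
    have "(\<Sum>i\<in>UNIV. (u x l $ i - l $ i)\<^sup>2 / k)
        = (\<Sum>i\<in>act. (u x l $ i - l $ i)\<^sup>2 / k) + (\<Sum>i\<in>-act. (u x l $ i - l $ i)\<^sup>2 / k)"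
      by (subst sum.union_disjoint[symmetric]) (auto simp: Compl_partition)
    moreover have "(\<Sum>i\<in>act. (u x l $ i - l $ i)\<^sup>2 / k) = k * (\<Sum>i\<in>act. (g x $ i)\<^sup>2)"
      using k_pos by (simp add: ul power_mult_distrib sum_distrib_left power2_eq_square mult_ac)
    moreover have "(\<Sum>i\<in>-act. (u x l $ i - l $ i)\<^sup>2 / k) = 1 / k * (\<Sum>i\<in>-act. (l $ i)\<^sup>2)"
      by (simp add: ul sum_divide_distrib)
    moreover have "k * (\<Sum>i\<in>act. (g x $ i)\<^sup>2) \<ge> k * (\<Sum>i\<in>act. 1/2 * (dg i xs \<bullet> d)\<^sup>2 - e * (norm d)\<^sup>2)"
      using k_pos by (intro mult_left_mono sum_mono sq) auto
    moreover have "(\<Sum>i\<in>act. 1/2 * (dg i xs \<bullet> d)\<^sup>2 - e * (norm d)\<^sup>2)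
        = 1/2 * (\<Sum>i\<in>act. (dg i xs \<bullet> d)\<^sup>2) - card act * (e * (norm d)\<^sup>2)"
      unfolding sum_subtractf sum_distrib_left by simp
    then have "k * (\<Sum>i\<in>act. 1/2 * (dg i xs \<bullet> d)\<^sup>2 - e * (norm d)\<^sup>2)
        = k/2 * (\<Sum>i\<in>act. (dg i xs \<bullet> d)\<^sup>2) - (e * (norm d)\<^sup>2) * (k * card act)"
      by (simp add: right_diff_distrib mult_ac)
    ultimately have 2: "(\<Sum>i\<in>UNIV. (u x l $ i - l $ i)\<^sup>2 / k)
        \<ge> k/2 * (\<Sum>i\<in>act. (dg i xs \<bullet> d)\<^sup>2) - (e * (norm d)\<^sup>2) * (k * card act) + 1 / k * (\<Sum>i\<in>-act. (l $ i)\<^sup>2)"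
      by linarith
    have 3: "1/4 * lagr_form d = 1/4 * (d \<bullet> (hessian f xs *v d)) + 1/4 * (\<Sum>i\<in>UNIV. ls $ i * ?q i)"
      by (simp add: lagr_form_def)
    have 4: "(e * (norm d)\<^sup>2) * D = e * (norm d)\<^sup>2 + (e * (norm d)\<^sup>2) * (\<Sum>i\<in>UNIV. ls $ i) + (e * (norm d)\<^sup>2) * (k * card act)"
      by (simp add: D_def distrib_left)
    have 5: "(e * (norm d)\<^sup>2) * D \<le> w0 / 2 * (norm d)\<^sup>2"
      using mult_right_mono[OF e(2), of "(norm d)\<^sup>2"] by (simp add: mult_ac)
    have "W x n l \<ge> w0 / 2 * (norm d)\<^sup>2 + 1 / k * (\<Sum>i\<in>-act. (l $ i)\<^sup>2)"
      using W_ge[of x l n] W_terms_nonneg(5)[of x l] bf 1 2 w0(2)[of d] unfolding A_diff[of x, folded d_def, symmetric]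
      using 3 4 5 by linarith
    moreover have "w * (norm d)\<^sup>2 \<le> w0 / 2 * (norm d)\<^sup>2"
      by (intro mult_right_mono) (auto simp: w_def)
    moreover have "w * (\<Sum>i\<in>-act. (l $ i)\<^sup>2) \<le> 1 / k * (\<Sum>i\<in>-act. (l $ i)\<^sup>2)"
      by (intro mult_right_mono sum_nonneg) (auto simp: w_def)
    ultimately show ?case
      unfolding x_def[symmetric] n_def[symmetric] l_def[symmetric] d_def[symmetric] distrib_left by linarith
  qed
  ultimately show ?thesis by blast
qed

lemma g_local:
  "\<exists>K\<ge>0. \<forall>\<^sub>F x in nhds xs. \<forall>i. \<bar>g x $ i - g xs $ i\<bar> \<le> K * norm (x - xs)"
  by (rule uniform_local_bound) (auto intro!: scalar_eventually_lipschitz g_differentiable)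

text \<open>For active \<open>i\<close> the residual is \<open>k * g x $ i\<close>, and
  \<open>g\<close> vanishes there at \<open>xs\<close>. The speed of the active multipliers is thus
  controlled by \<open>x - xs\<close> alone.\<close>

lemma multiplier_residual_local:
  "\<exists>K\<ge>0. \<forall>\<^sub>F z in nhds zs. \<forall>i\<in>act.
     \<bar>u (fst z) (snd (snd z)) $ i - snd (snd z) $ i\<bar> \<le> K * norm (fst z - xs)"
proof -
  obtain K where K: "K \<ge> 0" "\<forall>\<^sub>F x in nhds xs. \<forall>i. \<bar>g x $ i - g xs $ i\<bar> \<le> K * norm (x - xs)"
    using g_local by blast
  have "\<forall>\<^sub>F z in nhds zs. \<forall>i\<in>act.
     \<bar>u (fst z) (snd (snd z)) $ i - snd (snd z) $ i\<bar> \<le> (k * K) * norm (fst z - xs)"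
    using eventually_nhds_fst[OF K(2)] u_local
  proof eventually_elim
    case (elim z)
    show ?case
    proof
      fix i assume i: "i \<in> act"
      have "k * \<bar>g (fst z) $ i\<bar> \<le> k * (K * norm (fst z - xs))"
        using elim(1) active(1)[OF i] k_pos by (intro mult_left_mono) (auto dest: spec[of _ i])
      then show "\<bar>u (fst z) (snd (snd z)) $ i - snd (snd z) $ i\<bar> \<le> (k * K) * norm (fst z - xs)"
        using elim(2) i k_pos by (simp add: abs_mult mult.assoc)
    qed
  qed
  then show ?thesis using K(1) k_pos by (intro exI[of _ "k * K"]) auto
qed

text \<open>After subtracting stationarity, what \<open>G\<close> has beyond \<open>lin\<close>
  consists of gradient differences, the equality penalty and active residuals, each of order
  \<open>norm (x - xs)\<close>.\<close>

lemma G_local: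
  "\<exists>K\<ge>0. \<forall>\<^sub>F z in nhds zs.
     norm (G (fst z) (fst (snd z)) (snd (snd z)) - lin (fst (snd z)) (snd (snd z))) \<le> K * norm (fst z - xs)"
proof -
  obtain Kf where Kf: "Kf \<ge> 0" "\<forall>\<^sub>F x in nhds xs. norm (gradient f x - gradient f xs) \<le> Kf * norm (x - xs)"
    using gradient_eventually_lipschitz[OF conv_f C1_f twice_f] by blast
  have "\<exists>K\<ge>0. \<forall>\<^sub>F x in nhds xs. \<forall>i. norm (dg i x - dg i xs) \<le> K * norm (x - xs)"
    by (rule uniform_local_bound) (auto intro!: gradient_eventually_lipschitz conv_g C1_g twice_g)
  then obtain Kd where Kd: "Kd \<ge> 0" "\<forall>\<^sub>F x in nhds xs. \<forall>i. norm (dg i x - dg i xs) \<le> Kd * norm (x - xs)"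
    by blast
  obtain Ku where Ku: "Ku \<ge> 0" "\<forall>\<^sub>F z in nhds zs. \<forall>i\<in>act.
     \<bar>u (fst z) (snd (snd z)) $ i - snd (snd z) $ i\<bar> \<le> Ku * norm (fst z - xs)"
    using multiplier_residual_local by blast
  obtain N where N: "N > 0" "\<And>d. norm ((transpose A ** A) *v d) \<le> norm d * N"
    using bounded_linear.pos_bounded[OF matrix_vector_mul_bounded_linear] by blast
  \<comment> \<open>At the KKT point \<open>u\<close> equals \<open>ls\<close>, so by continuity it
    stays below \<open>ls + 1\<close> and can multiply the gradient differences safely.\<close>
  have bdd: "\<forall>\<^sub>F z in nhds zs. \<forall>i. ls $ i + 1 - u (fst z) (snd (snd z)) $ i > 0"
    by (intro eventually_all_finite eventually_nhds_pos continuous_intros continuous_u)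
       (simp add: u_nth flip: ls_eq_max)
  define K where "K = Kf + kp * N + (\<Sum>i\<in>act. (ls $ i + 1) * Kd + Ku * norm (dg i xs))"
  have "K \<ge> 0" using Kf Kd Ku N kp_pos feasible(3) by (auto simp: K_def intro!: add_nonneg_nonneg sum_nonneg)
  moreover have "\<forall>\<^sub>F z in nhds zs.
     norm (G (fst z) (fst (snd z)) (snd (snd z)) - lin (fst (snd z)) (snd (snd z))) \<le> K * norm (fst z - xs)"
    using eventually_nhds_fst[OF Kf(2)] eventually_nhds_fst[OF Kd(2)] Ku(2) bdd u_local
  proof eventually_elim
    case (elim z)
    define x where "x = fst z"
    define n where "n = fst (snd z)"
    define l where "l = snd (snd z)"
    define d where "d = x - xs"
    have kf: "norm (gradient f x - gradient f xs) \<le> Kf * norm d"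
      and kd: "\<And>i. norm (dg i x - dg i xs) \<le> Kd * norm d"
      and ku: "\<And>i. i \<in> act \<Longrightarrow> \<bar>u x l $ i - l $ i\<bar> \<le> Ku * norm d"
      and ub: "\<And>i. u x l $ i < ls $ i + 1"
      and ul: "\<And>i. i \<notin> act \<Longrightarrow> u x l $ i = 0"
      using elim by (auto simp: x_def l_def d_def less_diff_eq)
    let ?r = "\<lambda>i. u x l $ i *\<^sub>R (dg i x - dg i xs) + (u x l $ i - l $ i) *\<^sub>R dg i xs"
    have "(\<Sum>i\<in>UNIV. u x l $ i *\<^sub>R dg i x) = (\<Sum>i\<in>act. u x l $ i *\<^sub>R dg i x)"
      by (rule sum.mono_neutral_right) (auto simp: ul)
    moreover have "(\<Sum>i\<in>UNIV. ls $ i *\<^sub>R dg i xs) = (\<Sum>i\<in>act. ls $ i *\<^sub>R dg i xs)"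
      by (rule sum.mono_neutral_right) (auto simp: inactive)
    moreover have "(\<Sum>i\<in>act. u x l $ i *\<^sub>R dg i x) - (\<Sum>i\<in>act. ls $ i *\<^sub>R dg i xs)
        - (\<Sum>i\<in>act. (l - ls) $ i *\<^sub>R dg i xs) = (\<Sum>i\<in>act. ?r i)"
      unfolding sum_subtractf[symmetric] by (rule sum.cong) (simp_all add: algebra_simps)
    moreover have "transpose A *v (n + kp *\<^sub>R (A *v x - b)) = transpose A *v ns + transpose A *v (n - ns) + kp *\<^sub>R ((transpose A ** A) *v d)"
      by (simp add: d_def A_diff matrix_vector_right_distrib matrix_vector_mult_scaleR
          matrix_vector_mult_diff_distrib feasible(1) flip: matrix_vector_mul_assoc)
    moreover have "G x n l - lin n l = G x n l - lin n l
       - (gradient f xs + transpose A *v ns + (\<Sum>i\<in>UNIV. ls $ i *\<^sub>R dg i xs))"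
      by (simp only: stationary diff_zero)
    ultimately have eq: "G x n l - lin n l = (gradient f x - gradient f xs) + kp *\<^sub>R ((transpose A ** A) *v d)
       + (\<Sum>i\<in>act. ?r i)"
      by (simp add: G_def lin_def algebra_simps)
    have "norm (?r i) \<le> (ls $ i + 1) * (Kd * norm d) + (Ku * norm d) * norm (dg i xs)" if "i \<in> act" for i
    proof (rule norm_triangle_le, rule add_mono)
      show "norm (u x l $ i *\<^sub>R (dg i x - dg i xs)) \<le> (ls $ i + 1) * (Kd * norm d)"
        using ub[of i] u_nonneg[of x l i] kd[of i] by (auto intro!: mult_mono)
      show "norm ((u x l $ i - l $ i) *\<^sub>R dg i xs) \<le> (Ku * norm d) * norm (dg i xs)"
        using ku[OF that] by (auto intro!: mult_right_mono)
    qed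
    then have "norm (\<Sum>i\<in>act. ?r i) \<le> (\<Sum>i\<in>act. (ls $ i + 1) * (Kd * norm d) + (Ku * norm d) * norm (dg i xs))"
      by (intro order_trans[OF norm_sum] sum_mono)
    also have "\<dots> = (\<Sum>i\<in>act. (ls $ i + 1) * Kd + Ku * norm (dg i xs)) * norm d"
      unfolding sum_distrib_right by (rule sum.cong) (simp_all add: algebra_simps)
    finally have r: "norm (\<Sum>i\<in>act. ?r i) \<le> (\<Sum>i\<in>act. (ls $ i + 1) * Kd + Ku * norm (dg i xs)) * norm d" .
    have "norm (kp *\<^sub>R ((transpose A ** A) *v d)) \<le> kp * N * norm d"
      using N(2)[of d] kp_pos by (simp add: mult.commute mult.left_commute)
    with kf r have "norm (G x n l - lin n l) \<le> K * norm d"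
      unfolding eq K_def distrib_right by (intro norm_triangle_le add_mono) auto
    then show ?case by (simp add: x_def n_def l_def d_def)
  qed
  ultimately show ?thesis by blast
qed

end

section \<open>Convergence of trajectories\<close>

locale sppid_trajectory = sppid_gains f g A b xs ns ls kp k
  for f :: "real ^ 'n \<Rightarrow> real"
    and g :: "real ^ 'n \<Rightarrow> real ^ 'm"
    and A :: "real ^ 'n ^ 'p"
    and b xs ns ls kp k +
  fixes kd ki kl :: real and z :: "real \<Rightarrow> (real ^ 'n) \<times> (real ^ 'p) \<times> (real ^ 'm)"
  assumes kd_nonneg: "kd \<ge> 0" and ki_pos: "ki > 0" and kl_pos: "kl > 0"
    and traj: "trajectory (sppid_field f A b g kd kp ki k kl) z"
begin

abbreviation X where "X t \<equiv> fst (z t)"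
abbreviation N where "N t \<equiv> fst (snd (z t))"
abbreviation L where "L t \<equiv> snd (snd (z t))"

section \<open>The preconditioner and the components of the field\<close>

definition Mm :: "real ^ 'n ^ 'n" where "Mm = mat 1 + kd *\<^sub>R (transpose A ** A)"

lemma Mm_vec: "Mm *v d = d + kd *\<^sub>R (transpose A *v (A *v d))"
  by (simp add: Mm_def matrix_vector_mult_add_rdistrib scaleR_matrix_vector_assoc[symmetric]
      matrix_vector_mul_assoc)

lemma Mm_form: "a \<bullet> (Mm *v d) = a \<bullet> d + kd * ((A *v a) \<bullet> (A *v d))"
  using inner_transpose_A[of "A *v d" a] by (simp add: Mm_vec inner_add_right inner_commute)

lemma Mm_symmetric: "a \<bullet> (Mm *v d) = (Mm *v a) \<bullet> d"
  using Mm_form[of a d] Mm_form[of d a] by (simp add: inner_commute)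

lemma Mm_form_ge: "d \<bullet> (Mm *v d) \<ge> (norm d)\<^sup>2"
  using kd_nonneg by (simp add: Mm_form power2_norm_eq_inner)

text \<open>By \<open>Mm_form_ge\<close> the kernel is trivial, so the square matrix is
  invertible.\<close>

lemma Mm_inv: "Mm *v (matrix_inv Mm *v y) = y"
proof -
  have "d = 0" if "Mm *v d = 0" for d
    using Mm_form_ge[of d] that by simp
  then have "invertible Mm"
    by (metis matrix_left_invertible_ker invertible_left_inverse)
  then have "Mm ** matrix_inv Mm = mat 1"
    unfolding matrix_inv_def invertible_def by (rule someI2_ex) blast
  then show ?thesis
    by (simp add: matrix_vector_mul_assoc)
qed

definition Xd :: "real \<Rightarrow> real ^ 'n" where "Xd t = - (matrix_inv Mm *v G (X t) (N t) (L t))"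

lemma Mm_Xd: "Mm *v Xd t = - G (X t) (N t) (L t)"
  using matrix_vector_mult_scaleR[of Mm "-1"] by (simp add: Xd_def Mm_inv)

definition F :: "(real ^ 'n) \<times> (real ^ 'p) \<times> (real ^ 'm) \<Rightarrow> (real ^ 'n) \<times> (real ^ 'p) \<times> (real ^ 'm)" where
  "F y = (- (matrix_inv Mm *v G (fst y) (fst (snd y)) (snd (snd y))),
     ki *\<^sub>R (A *v fst y - b), kl *\<^sub>R (u (fst y) (snd (snd y)) - snd (snd y)))"

lemma field_eq: "sppid_field f A b g kd kp ki k kl = F"
  by (rule ext) (simp add: sppid_field_def F_def G_def u_def Mm_def jacobian_term case_prod_beta
      scaleR_diff_right)

lemma deriv_z: "t \<ge> 0 \<Longrightarrow> (z has_vector_derivative F (z t)) (at t within {0..})"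
  using traj by (simp add: trajectory_def field_eq)

lemma deriv_X: "t \<ge> 0 \<Longrightarrow> (X has_vector_derivative Xd t) (at t within {0..})"
  using bounded_linear.has_vector_derivative[OF bounded_linear_fst deriv_z]
  by (simp add: F_def Xd_def)

lemma deriv_N: "t \<ge> 0 \<Longrightarrow> (N has_vector_derivative ki *\<^sub>R (A *v X t - b)) (at t within {0..})"
  using bounded_linear.has_vector_derivative[OF bounded_linear_compose[OF bounded_linear_fst bounded_linear_snd] deriv_z]
  by (simp add: F_def)

lemma deriv_L: "t \<ge> 0 \<Longrightarrow> (L has_vector_derivative kl *\<^sub>R (u (X t) (L t) - L t)) (at t within {0..})"
  using bounded_linear.has_vector_derivative[OF bounded_linear_compose[OF bounded_linear_snd bounded_linear_snd] deriv_z]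
  by (simp add: F_def)

section \<open>The Lyapunov function and boundedness of the trajectory\<close>

definition V :: "real \<Rightarrow> real" where
  "V t = 1/2 * ((X t - xs) \<bullet> (Mm *v (X t - xs)) + (N t - ns) \<bullet> (N t - ns) / ki
            + (L t - ls) \<bullet> (L t - ls) / (kl * k))"

text \<open>The weights of \<open>V\<close> are made for this: \<open>Mm\<close> undoes the
  preconditioner, \<open>1 / ki\<close> and \<open>1 / (kl * k)\<close> undo the gains, and 1/2
  undoes the doubling by symmetry.\<close>

lemma deriv_V:
  assumes "t \<ge> 0"
  shows "(V has_real_derivative - W (X t) (N t) (L t)) (at t within {0..})"
proof -
  note dX = has_vector_derivative_shift[OF deriv_X[OF assms], of xs]
  have "(V has_real_derivative 1/2 *
      (((X t - xs) \<bullet> (Mm *v Xd t) + Xd t \<bullet> (Mm *v (X t - xs)))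
       + ((N t - ns) \<bullet> (ki *\<^sub>R (A *v X t - b)) + (ki *\<^sub>R (A *v X t - b)) \<bullet> (N t - ns)) / ki
       + ((L t - ls) \<bullet> (kl *\<^sub>R (u (X t) (L t) - L t)) + (kl *\<^sub>R (u (X t) (L t) - L t)) \<bullet> (L t - ls)) / (kl * k)))
      (at t within {0..})"
    unfolding V_def
    by (intro DERIV_cmult DERIV_add DERIV_cdivide has_real_derivative_inner
        has_vector_derivative_matrix_vector dX has_vector_derivative_shift deriv_N deriv_L assms)
  moreover have "Xd t \<bullet> (Mm *v (X t - xs)) = (X t - xs) \<bullet> (Mm *v Xd t)"
    by (metis Mm_symmetric inner_commute)
  moreover have "(X t - xs) \<bullet> (Mm *v Xd t) = - (G (X t) (N t) (L t) \<bullet> (X t - xs))"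
    by (simp add: Mm_Xd inner_commute)
  moreover have "((N t - ns) \<bullet> (ki *\<^sub>R (A *v X t - b)) + (ki *\<^sub>R (A *v X t - b)) \<bullet> (N t - ns)) / ki
      = 2 * ((A *v X t - b) \<bullet> (N t - ns))"
    using ki_pos by (simp only: inner_commute[of "N t - ns"] inner_scaleR_left) simp
  moreover have "((L t - ls) \<bullet> (kl *\<^sub>R (u (X t) (L t) - L t)) + (kl *\<^sub>R (u (X t) (L t) - L t)) \<bullet> (L t - ls)) / (kl * k)
      = 2 * ((u (X t) (L t) - L t) \<bullet> (L t - ls) / k)"
    using kl_pos by (simp only: inner_commute[of "L t - ls"] inner_scaleR_left) simp
  ultimately show ?thesis
    by (simp only: W_def) (simp add: algebra_simps)
qed

lemma norm_z: "(norm (y - zs))\<^sup>2 = (norm (fst y - xs))\<^sup>2 + (norm (fst (snd y) - ns))\<^sup>2 + (norm (snd (snd y) - ls))\<^sup>2"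
  by (cases y) (simp add: norm_Pair)

lemma V_ge: "\<exists>v>0. \<forall>t. v * (norm (z t - zs))\<^sup>2 \<le> V t"
proof (intro exI conjI allI)
  define v where "v = 1/2 * min 1 (min (1 / ki) (1 / (kl * k)))"
  show "v > 0" using ki_pos kl_pos k_pos by (simp add: v_def)
  fix t
  have "v * (norm (X t - xs))\<^sup>2 \<le> 1/2 * (norm (X t - xs))\<^sup>2"
    "v * (norm (N t - ns))\<^sup>2 \<le> 1/2 * (1 / ki) * (norm (N t - ns))\<^sup>2"
    "v * (norm (L t - ls))\<^sup>2 \<le> 1/2 * (1 / (kl * k)) * (norm (L t - ls))\<^sup>2"
    by (intro mult_right_mono; simp add: v_def)+
  then show "v * (norm (z t - zs))\<^sup>2 \<le> V t"
    using Mm_form_ge[of "X t - xs"] unfolding norm_z distrib_left V_def power2_norm_eq_inner[symmetric]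
    by simp
qed

lemma V_le: "\<exists>v>0. \<forall>t. V t \<le> v * (norm (z t - zs))\<^sup>2"
proof -
  obtain B where B: "B > 0" "\<And>d. norm (Mm *v d) \<le> norm d * B"
    using bounded_linear.pos_bounded[OF matrix_vector_mul_bounded_linear] by blast
  define v where "v = B + 1 / ki + 1 / (kl * k)"
  have pos: "1 / ki > 0" "1 / (kl * k) > 0" using ki_pos kl_pos k_pos by auto
  with B(1) have "v > 0" by (simp only: v_def add_pos_pos)
  moreover have "V t \<le> v * (norm (z t - zs))\<^sup>2" for t
  proof -
    have "(X t - xs) \<bullet> (Mm *v (X t - xs)) \<le> norm (X t - xs) * (norm (X t - xs) * B)"
      by (rule order_trans[OF norm_cauchy_schwarz]) (intro mult_left_mono B norm_ge_zero)
    then have 1: "(X t - xs) \<bullet> (Mm *v (X t - xs)) \<le> B * (norm (X t - xs))\<^sup>2"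
      by (simp add: power2_eq_square mult_ac)
    have 2: "B * (norm (X t - xs))\<^sup>2 \<le> v * (norm (X t - xs))\<^sup>2"
      "1 / ki * (norm (N t - ns))\<^sup>2 \<le> v * (norm (N t - ns))\<^sup>2"
      "1 / (kl * k) * (norm (L t - ls))\<^sup>2 \<le> v * (norm (L t - ls))\<^sup>2"
      using B pos by (intro mult_right_mono; simp add: v_def)+
    have 3: "V t = 1/2 * ((X t - xs) \<bullet> (Mm *v (X t - xs)) + 1 / ki * (norm (N t - ns))\<^sup>2
        + 1 / (kl * k) * (norm (L t - ls))\<^sup>2)"
      by (simp add: V_def power2_norm_eq_inner)
    have 4: "v * (norm (z t - zs))\<^sup>2 \<ge> 0" using \<open>v > 0\<close> by simp
    show ?thesis using 1 2 4 unfolding 3 norm_z distrib_left by linarith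
  qed
  ultimately show ?thesis by blast
qed

lemma V_nonneg: "V t \<ge> 0"
proof -
  obtain v where "v > 0" "v * (norm (z t - zs))\<^sup>2 \<le> V t" using V_ge by blast
  then show ?thesis by (meson less_imp_le mult_nonneg_nonneg order_trans zero_le_power2)
qed

lemma V_nonincreasing: "0 \<le> s \<Longrightarrow> s \<le> t \<Longrightarrow> V t \<le> V s"
  using nonincreasing_from_derivative[OF deriv_V, of s t] by (simp add: W_nonneg)

lemma bounded_trajectory: "\<exists>R>0. \<forall>t\<ge>0. norm (z t - zs) \<le> R"
proof -
  obtain v where v: "v > 0" "\<And>t. v * (norm (z t - zs))\<^sup>2 \<le> V t" using V_ge by blast
  \<comment> \<open>The summand 1 keeps the radius positive even for a trajectory that starts at the
    KKT point.\<close>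
  have "norm (z t - zs) \<le> sqrt (V 0 / v) + 1" if "t \<ge> 0" for t
  proof -
    have "(norm (z t - zs))\<^sup>2 \<le> V 0 / v"
      using v(2)[of t] V_nonincreasing[of 0 t] that v(1) by (simp add: field_simps)
    then have "norm (z t - zs) \<le> sqrt (V 0 / v)" by (rule real_le_rsqrt)
    then show ?thesis by simp
  qed
  moreover have "sqrt (V 0 / v) + 1 > 0" using V_nonneg[of 0] v(1) by (intro add_nonneg_pos) auto
  ultimately show ?thesis by blast
qed

section \<open>Asymptotic convergence by Barbalat's lemma\<close>

lemma continuous_F: "continuous_on UNIV F"
  unfolding F_def
  by (intro continuous_intros continuous_G continuous_u
      continuous_on_compose2[OF matrix_vector_mult_linear_continuous_on[of UNIV]]) auto

text \<open>The trajectory stays in a compact ball, on which the field is bounded; a bounded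
  velocity makes it Lipschitz.\<close>

lemma uniformly_continuous_trajectory: "uniformly_continuous_on {0..} z"
proof -
  obtain R where R: "\<And>t. t \<ge> 0 \<Longrightarrow> norm (z t - zs) \<le> R" using bounded_trajectory by blast
  have "bounded (F ` cball zs R)"
    by (intro compact_imp_bounded compact_continuous_image continuous_on_subset[OF continuous_F]) auto
  then obtain B where B: "B > 0" "\<And>y. y \<in> cball zs R \<Longrightarrow> norm (F y) \<le> B"
    by (auto simp: bounded_pos)
  have "B-lipschitz_on {0..} z"
  proof (rule bounded_derivative_imp_lipschitz)
    show "(z has_derivative (\<lambda>h. h *\<^sub>R F (z t))) (at t within {0..})" if "t \<in> {0..}" for t
      using deriv_z[of t] that by (simp add: has_vector_derivative_def)
    show "onorm (\<lambda>h. h *\<^sub>R F (z t)) \<le> B" if "t \<in> {0..}" for t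
      using B(2)[of "z t"] R[of t] that
      by (intro onorm_le) (simp add: dist_norm norm_minus_commute mult_left_mono mult.commute[of B])
  qed (use B in auto)
  then show ?thesis by (rule lipschitz_on_uniformly_continuous)
qed

lemma uniformly_continuous_along:
  fixes h :: "_ \<Rightarrow> 'z::metric_space"
  assumes "continuous_on UNIV h"
  shows "uniformly_continuous_on {0..} (\<lambda>t. h (z t))"
proof (rule uniformly_continuous_on_compose[OF uniformly_continuous_trajectory])
  obtain R where R: "\<And>t. t \<ge> 0 \<Longrightarrow> norm (z t - zs) \<le> R" using bounded_trajectory by blast
  then have "z ` {0..} \<subseteq> cball zs R" by (auto simp: dist_norm norm_minus_commute)
  moreover have "uniformly_continuous_on (cball zs R) h"
    by (intro compact_uniformly_continuous continuous_on_subset[OF assms]) auto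
  ultimately show "uniformly_continuous_on (z ` {0..}) h"
    unfolding uniformly_continuous_on_def by (meson subsetD)
qed

text \<open>The compact ball that contains the trajectory allows
  \<open>tendsto_zero_via_compact\<close>; this takes the place of an invariance principle.\<close>

lemma vanishes_along:
  assumes "continuous_on UNIV p" "continuous_on UNIV q" "\<And>y. p y = (0::real) \<Longrightarrow> q y = (0::real)"
    and "((\<lambda>t. p (z t)) \<longlongrightarrow> 0) at_top"
  shows "((\<lambda>t. q (z t)) \<longlongrightarrow> 0) at_top"
proof -
  obtain R where R: "\<And>t. t \<ge> 0 \<Longrightarrow> norm (z t - zs) \<le> R" using bounded_trajectory by blast
  show ?thesis
  proof (rule tendsto_zero_via_compact[where K = "cball zs R" and p = p])
    show "\<forall>\<^sub>F t in at_top. z t \<in> cball zs R"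
      using eventually_ge_at_top[of 0]
      by eventually_elim (use R in \<open>simp add: dist_norm norm_minus_commute\<close>)
  qed (use assms in \<open>auto intro: continuous_on_subset\<close>)
qed

lemma W_tendsto_0: "((\<lambda>t. W (X t) (N t) (L t)) \<longlongrightarrow> 0) at_top"
proof -
  have "\<exists>l. (V \<longlongrightarrow> l) at_top"
    by (rule nonincreasing_nonneg_convergent) (rule V_nonincreasing V_nonneg; assumption)+
  then obtain l where "(V \<longlongrightarrow> l) at_top" by blast
  then have "((\<lambda>t. - W (X t) (N t) (L t)) \<longlongrightarrow> 0) at_top"
  proof (rule barbalat[rotated 2])
    show "uniformly_continuous_on {0..} (\<lambda>t. - W (X t) (N t) (L t))"
      by (rule uniformly_continuous_along[of "\<lambda>y. - W (fst y) (fst (snd y)) (snd (snd y))"])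
         (intro continuous_on_minus continuous_W)
  qed (use deriv_V in \<open>simp add: has_real_derivative_iff_has_vector_derivative\<close>)
  then have "((\<lambda>t. - (- W (X t) (N t) (L t))) \<longlongrightarrow> - 0) at_top" by (rule tendsto_minus)
  then show ?thesis by simp
qed

text \<open>The dissipation sees only the zero set of \<open>W\<close>, which fixes \<open>x\<close>
  but not all multipliers. Convergence of \<open>X\<close> permits a second use of Barbalat's lemma,
  whose conclusion on the velocity is one on \<open>G\<close> after applying
  \<open>Mm\<close>.\<close>

lemma G_tendsto_0: "((\<lambda>t. norm (G (X t) (N t) (L t))) \<longlongrightarrow> 0) at_top"
proof -
  have "((\<lambda>t. norm (X t - xs)) \<longlongrightarrow> 0) at_top"
    by (rule vanishes_along[OF continuous_W _ _ W_tendsto_0, of "\<lambda>y. norm (fst y - xs)"])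
       (auto intro!: continuous_intros dest: W_eq_0D)
  then have "(X \<longlongrightarrow> xs) at_top"
    by (simp add: tendsto_norm_zero_iff LIM_zero_iff)
  then have "(Xd \<longlongrightarrow> 0) at_top"
  proof (rule barbalat[rotated 2])
    have "continuous_on UNIV (\<lambda>y. fst (F y))" by (intro continuous_intros continuous_F)
    from uniformly_continuous_along[OF this] show "uniformly_continuous_on {0..} Xd"
      by (simp add: F_def Xd_def[abs_def])
  qed (fact deriv_X)
  then have "((\<lambda>t. norm (- (Mm *v Xd t))) \<longlongrightarrow> norm (- (Mm *v (0 :: real ^ 'n)))) at_top"
    by (intro tendsto_intros bounded_linear.tendsto[OF matrix_vector_mul_bounded_linear])
  then show ?thesis by (simp add: Mm_Xd)
qed

lemma trajectory_tendsto: "(z \<longlongrightarrow> zs) at_top"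
proof -
  \<comment> \<open>Both summands are nonnegative, so \<open>?p\<close> vanishes only where both do,
    which is at \<open>zs\<close>.\<close>
  let ?p = "\<lambda>y. W (fst y) (fst (snd y)) (snd (snd y)) + norm (G (fst y) (fst (snd y)) (snd (snd y)))"
  have "((\<lambda>t. norm (z t - zs)) \<longlongrightarrow> 0) at_top"
  proof (rule vanishes_along[of ?p "\<lambda>y. norm (y - zs)"])
    show "continuous_on UNIV ?p" by (intro continuous_intros continuous_W continuous_G)
    show "((\<lambda>t. ?p (z t)) \<longlongrightarrow> 0) at_top"
      using tendsto_add[OF W_tendsto_0 G_tendsto_0] by simp
    fix y assume "?p y = 0"
    with W_nonneg[of "fst y" "fst (snd y)" "snd (snd y)"]
    have "W (fst y) (fst (snd y)) (snd (snd y)) = 0" "G (fst y) (fst (snd y)) (snd (snd y)) = 0"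
      by (metis add_nonneg_eq_0_iff norm_ge_zero, metis add_nonneg_eq_0_iff norm_ge_zero norm_eq_zero)
    from equilibrium_unique[OF this] show "norm (y - zs) = 0" by (simp add: prod_eq_iff)
  qed (intro continuous_intros)
  then show ?thesis by (simp add: tendsto_norm_zero_iff LIM_zero_iff)
qed

section \<open>The cross term\<close>

definition S :: "real \<Rightarrow> real" where "S t = (Mm *v (X t - xs)) \<bullet> lin (N t) (L t)"

definition lin_rate :: "real \<Rightarrow> real ^ 'n" where
  "lin_rate t = transpose A *v (ki *\<^sub>R (A *v X t - b))
     + (\<Sum>i\<in>act. (kl * (u (X t) (L t) $ i - L t $ i)) *\<^sub>R dg i xs)"

text \<open>The factor \<open>Mm\<close> in \<open>S\<close> cancels the preconditioner and produces
  \<open>- G \<bullet> lin\<close>, which supplies the dissipation in the multipliers;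
  \<open>lin_rate\<close> is the velocity of \<open>lin\<close>.\<close>

lemma deriv_S:
  assumes "t \<ge> 0"
  shows "(S has_real_derivative (Mm *v (X t - xs)) \<bullet> lin_rate t - G (X t) (N t) (L t) \<bullet> lin (N t) (L t))
     (at t within {0..})"
proof -
  have "((\<lambda>t. (L t - ls) $ i *\<^sub>R dg i xs) has_vector_derivative
      (kl * (u (X t) (L t) $ i - L t $ i)) *\<^sub>R dg i xs) (at t within {0..})" for i
    using bounded_linear.has_vector_derivative[OF bounded_linear_compose[OF bounded_linear_scaleR_left
        bounded_linear_vec_nth] has_vector_derivative_shift[OF deriv_L[OF assms], of ls]] by simp
  then have "((\<lambda>t. lin (N t) (L t)) has_vector_derivative lin_rate t) (at t within {0..})"
    unfolding lin_def lin_rate_def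
    by (intro has_vector_derivative_add has_vector_derivative_sum has_vector_derivative_matrix_vector
        has_vector_derivative_shift deriv_N assms)
  from has_real_derivative_inner[OF has_vector_derivative_matrix_vector[OF has_vector_derivative_shift[OF deriv_X[OF assms]]] this, of Mm xs]
  show ?thesis unfolding S_def by (simp add: Mm_Xd)
qed

subsection \<open>Exponential decay\<close>

lemma S_bound: "\<exists>K\<ge>0. \<forall>t. \<bar>S t\<bar> \<le> K * (norm (z t - zs))\<^sup>2"
proof -
  obtain B where B: "B > 0" "\<And>d. norm (Mm *v d) \<le> norm d * B"
    using bounded_linear.pos_bounded[OF matrix_vector_mul_bounded_linear] by blast
  obtain a where a: "a > 0" "\<And>n. norm (transpose A *v n) \<le> norm n * a"
    using bounded_linear.pos_bounded[OF matrix_vector_mul_bounded_linear] by blast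
  define c where "c = a + (\<Sum>i\<in>act. norm (dg i xs))"
  have "c \<ge> 0" using a by (auto simp: c_def intro!: add_nonneg_nonneg sum_nonneg)
  have "\<bar>S t\<bar> \<le> (B * c) * (norm (z t - zs))\<^sup>2" for t
  proof -
    let ?r = "norm (z t - zs)"
    have r: "norm (X t - xs) \<le> ?r" "norm (N t - ns) \<le> ?r" "norm (L t - ls) \<le> ?r"
      by (rule power2_le_imp_le; simp add: norm_z)+
    have "norm ((L t - ls) $ i *\<^sub>R dg i xs) \<le> ?r * norm (dg i xs)" for i
      using component_le_norm_cart[of "L t - ls" i] r(3)
      by (simp add: mult_right_mono)
    then have "norm (\<Sum>i\<in>act. (L t - ls) $ i *\<^sub>R dg i xs) \<le> (\<Sum>i\<in>act. ?r * norm (dg i xs))"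
      by (intro order_trans[OF norm_sum] sum_mono)
    moreover have "norm (transpose A *v (N t - ns)) \<le> ?r * a"
      using a(2)[of "N t - ns"] mult_right_mono[OF r(2), of a] a(1) by linarith
    ultimately have "norm (lin (N t) (L t)) \<le> ?r * a + (\<Sum>i\<in>act. ?r * norm (dg i xs))"
      unfolding lin_def by (intro norm_triangle_le add_mono)
    also have "\<dots> = c * ?r"
      by (simp add: c_def algebra_simps sum_distrib_left)
    finally have "norm (lin (N t) (L t)) \<le> c * ?r" .
    moreover have "norm (Mm *v (X t - xs)) \<le> B * ?r"
      using B(2)[of "X t - xs"] mult_right_mono[OF r(1) less_imp_le[OF B(1)]]
      unfolding mult.commute[of B] by (rule order_trans)
    ultimately have "norm (Mm *v (X t - xs)) * norm (lin (N t) (L t)) \<le> (B * ?r) * (c * ?r)"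
      using B(1) by (intro mult_mono) auto
    then show ?thesis
      unfolding S_def using Cauchy_Schwarz_ineq2[of "Mm *v (X t - xs)" "lin (N t) (L t)"]
      by (simp add: power2_eq_square mult_ac)
  qed
  then show ?thesis using B \<open>c \<ge> 0\<close> by (intro exI[of _ "B * c"]) auto
qed

lemma eventually_along:
  "\<forall>\<^sub>F y in nhds zs. P y \<Longrightarrow> \<forall>\<^sub>F t in at_top. P (z t)"
  using trajectory_tendsto by (rule eventually_compose_filterlim[rotated])

text \<open>Near the KKT point \<open>G\<close> differs from \<open>lin\<close> by order
  \<open>norm (x - xs)\<close>, and \<open>lin_rate\<close> is itself of that order because it
  consists of the equality error and active residuals.\<close>

lemma S_rate:
  "\<exists>K\<ge>0. \<forall>\<^sub>F t in at_top. (Mm *v (X t - xs)) \<bullet> lin_rate t - G (X t) (N t) (L t) \<bullet> lin (N t) (L t)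
     \<le> - 1/2 * (norm (lin (N t) (L t)))\<^sup>2 + K * (norm (X t - xs))\<^sup>2"
proof -
  obtain KG where KG: "KG \<ge> 0" "\<forall>\<^sub>F z in nhds zs.
     norm (G (fst z) (fst (snd z)) (snd (snd z)) - lin (fst (snd z)) (snd (snd z))) \<le> KG * norm (fst z - xs)"
    using G_local by blast
  obtain Ku where Ku: "Ku \<ge> 0" "\<forall>\<^sub>F z in nhds zs. \<forall>i\<in>act.
     \<bar>u (fst z) (snd (snd z)) $ i - snd (snd z) $ i\<bar> \<le> Ku * norm (fst z - xs)"
    using multiplier_residual_local by blast
  obtain B where B: "B > 0" "\<And>d. norm (Mm *v d) \<le> norm d * B"
    using bounded_linear.pos_bounded[OF matrix_vector_mul_bounded_linear] by blast
  obtain a where a: "a > 0" "\<And>d. norm ((transpose A ** A) *v d) \<le> norm d * a"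
    using bounded_linear.pos_bounded[OF matrix_vector_mul_bounded_linear] by blast
  define c where "c = ki * a + (\<Sum>i\<in>act. kl * Ku * norm (dg i xs))"
  have "c \<ge> 0" using a ki_pos kl_pos Ku(1) by (auto simp: c_def intro!: add_nonneg_nonneg sum_nonneg)
  define K where "K = B * c + 1/2 * KG\<^sup>2"
  have "K \<ge> 0" using B(1) \<open>c \<ge> 0\<close> by (simp add: K_def)
  moreover have "\<forall>\<^sub>F t in at_top. (Mm *v (X t - xs)) \<bullet> lin_rate t - G (X t) (N t) (L t) \<bullet> lin (N t) (L t)
     \<le> - 1/2 * (norm (lin (N t) (L t)))\<^sup>2 + K * (norm (X t - xs))\<^sup>2"
    using eventually_along[OF KG(2)] eventually_along[OF Ku(2)]
  proof eventually_elim
    case (elim t)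
    define d where "d = X t - xs"
    define G' where "G' = G (X t) (N t) (L t)"
    define l where "l = lin (N t) (L t)"
    have eqd: "ki *\<^sub>R ((transpose A ** A) *v d) = transpose A *v (ki *\<^sub>R (A *v X t - b))"
      by (simp add: d_def A_diff matrix_vector_mult_scaleR flip: matrix_vector_mul_assoc)
    have "norm ((kl * (u (X t) (L t) $ i - L t $ i)) *\<^sub>R dg i xs) \<le> (kl * Ku * norm (dg i xs)) * norm d"
      if "i \<in> act" for i
    proof -
      have "kl * \<bar>u (X t) (L t) $ i - L t $ i\<bar> * norm (dg i xs) \<le> kl * (Ku * norm d) * norm (dg i xs)"
        using elim(2) that kl_pos by (intro mult_right_mono mult_left_mono) (auto simp: d_def)
      then show ?thesis using kl_pos by (simp add: abs_mult mult_ac)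
    qed
    then have "norm (\<Sum>i\<in>act. (kl * (u (X t) (L t) $ i - L t $ i)) *\<^sub>R dg i xs)
        \<le> (\<Sum>i\<in>act. (kl * Ku * norm (dg i xs)) * norm d)"
      by (intro order_trans[OF norm_sum] sum_mono)
    moreover have "norm (ki *\<^sub>R ((transpose A ** A) *v d)) \<le> (ki * a) * norm d"
      using mult_left_mono[OF a(2)[of d], of ki] ki_pos by (simp add: mult_ac)
    ultimately have lr: "norm (lin_rate t) \<le> c * norm d"
      unfolding lin_rate_def c_def eqd[symmetric] distrib_right sum_distrib_right
      by (intro norm_triangle_le add_mono)
    have "norm (Mm *v d) * norm (lin_rate t) \<le> (B * norm d) * (c * norm d)"
      using B(2)[of d] B(1) lr by (intro mult_mono) (auto simp: mult.commute)
    then have 1: "(Mm *v d) \<bullet> lin_rate t \<le> B * c * (norm d)\<^sup>2"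
      using norm_cauchy_schwarz[of "Mm *v d" "lin_rate t"] by (simp add: power2_eq_square mult_ac)
    have "norm (G' - l) \<le> KG * norm d" using elim(1) by (simp add: G'_def l_def d_def)
    then have "(norm (G' - l))\<^sup>2 \<le> (KG * norm d)\<^sup>2" by (intro power_mono) auto
    \<comment> \<open>Dropping the square on the left gives Young's inequality with constant
      1/2.\<close>
    moreover have "(norm G')\<^sup>2 = (norm (G' - l))\<^sup>2 + 2 * (G' \<bullet> l) - (norm l)\<^sup>2"
      by (simp add: power2_norm_eq_inner inner_diff_left inner_diff_right inner_commute)
    moreover have "(norm G')\<^sup>2 \<ge> 0" by simp
    ultimately have 2: "- (G' \<bullet> l) \<le> - 1/2 * (norm l)\<^sup>2 + 1/2 * KG\<^sup>2 * (norm d)\<^sup>2"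
      by (simp add: power_mult_distrib)
    show ?case
      using 1 2 by (simp add: K_def distrib_right flip: d_def G'_def l_def)
  qed
  ultimately show ?thesis by blast
qed

lemma exponential_convergence:
  "\<exists>a>0. \<exists>q>0. \<forall>t\<ge>0. norm (z t - zs) \<le> q * exp (- a * t)"
proof -
  obtain w where w: "w > 0" "\<forall>\<^sub>F z in nhds zs.
     w * ((norm (fst z - xs))\<^sup>2 + (\<Sum>i\<in>-act. (snd (snd z) $ i)\<^sup>2)) \<le> W (fst z) (fst (snd z)) (snd (snd z))"
    using W_local by blast
  obtain \<kappa> where \<kappa>: "\<kappa> > 0" "\<And>n l. \<kappa> * ((norm (n - ns))\<^sup>2 + (norm (l - ls))\<^sup>2)
     \<le> (norm (lin n l))\<^sup>2 + (\<Sum>i\<in>-act. (l $ i)\<^sup>2)"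
    using lin_coercive by blast
  obtain K where K: "K \<ge> 0" "\<forall>\<^sub>F t in at_top.
      (Mm *v (X t - xs)) \<bullet> lin_rate t - G (X t) (N t) (L t) \<bullet> lin (N t) (L t)
      \<le> - 1/2 * (norm (lin (N t) (L t)))\<^sup>2 + K * (norm (X t - xs))\<^sup>2"
    using S_rate by blast
  obtain s where s: "s \<ge> 0" "\<And>t. \<bar>S t\<bar> \<le> s * (norm (z t - zs))\<^sup>2" using S_bound by blast
  obtain v1 where v1: "v1 > 0" "\<And>t. v1 * (norm (z t - zs))\<^sup>2 \<le> V t" using V_ge by blast
  obtain v2 where v2: "v2 > 0" "\<And>t. V t \<le> v2 * (norm (z t - zs))\<^sup>2" using V_le by blast
  obtain R where R: "R > 0" "\<And>t. t \<ge> 0 \<Longrightarrow> norm (z t - zs) \<le> R" using bounded_trajectory by blast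
  \<comment> \<open>The three bounds leave enough of \<open>W\<close> for the inactive multipliers,
    let \<open>W\<close> absorb the growth \<open>K\<close> of the cross term, and keep
    \<open>V + e * S\<close> comparable to the squared distance. Adding 1 guards against
    \<open>K = 0\<close> and \<open>s = 0\<close>.\<close>
  define e where "e = min w (min (w / (2 * (K + 1))) (v1 / (2 * (s + 1))))"
  have e: "e > 0" "e \<le> w" "e * K \<le> w / 2" "e * s \<le> v1 / 2"
  proof -
    show "e > 0" using w(1) K(1) v1(1) s(1) by (simp add: e_def add_nonneg_pos)
    show "e \<le> w" by (simp add: e_def)
    have "e * K \<le> e * (K + 1)" using \<open>e > 0\<close> by simp
    also have "\<dots> \<le> w / (2 * (K + 1)) * (K + 1)" using K(1) by (intro mult_right_mono) (auto simp: e_def)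
    also have "\<dots> = w / 2" using K(1) by (simp add: field_simps)
    finally show "e * K \<le> w / 2" .
    have "e * s \<le> e * (s + 1)" using \<open>e > 0\<close> by simp
    also have "\<dots> \<le> v1 / (2 * (s + 1)) * (s + 1)" using s(1) by (intro mult_right_mono) (auto simp: e_def)
    also have "\<dots> = v1 / 2" using s(1) by (simp add: field_simps)
    finally show "e * s \<le> v1 / 2" .
  qed
  define E where "E t = V t + e * S t" for t
  define E' where "E' t = - W (X t) (N t) (L t)
     + e * ((Mm *v (X t - xs)) \<bullet> lin_rate t - G (X t) (N t) (L t) \<bullet> lin (N t) (L t))" for t
  define \<delta> where "\<delta> = min (w / 2) (e / 2 * \<kappa>)"
  define v where "v = v2 + v1 / 2"
  have pos: "\<delta> > 0" "v > 0" using w(1) e(1) \<kappa>(1) v1(1) v2(1) by (auto simp: \<delta>_def v_def)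
  have eS: "\<bar>e * S t\<bar> \<le> v1 / 2 * (norm (z t - zs))\<^sup>2" for t
  proof -
    have "\<bar>e * S t\<bar> \<le> e * (s * (norm (z t - zs))\<^sup>2)"
      using s(2)[of t] e(1) by (simp add: abs_mult)
    also have "\<dots> \<le> v1 / 2 * (norm (z t - zs))\<^sup>2"
      using mult_right_mono[OF e(4), of "(norm (z t - zs))\<^sup>2"] by (simp add: mult.assoc)
    finally show ?thesis .
  qed
  have E_ge: "v1 / 2 * (norm (z t - zs))\<^sup>2 \<le> E t" for t
    using eS[of t] v1(2)[of t] by (auto simp: E_def abs_le_iff)
  have E_le: "E t \<le> v * (norm (z t - zs))\<^sup>2" for t
    using eS[of t] v2(2)[of t] by (auto simp: E_def v_def distrib_right abs_le_iff)
  have "\<forall>\<^sub>F t in at_top. E' t \<le> - \<delta> * (norm (z t - zs))\<^sup>2"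
    using eventually_along[OF w(2)] K(2)
  proof eventually_elim
    case (elim t)
    define dx where "dx = (norm (X t - xs))\<^sup>2"
    define c where "c = (norm (lin (N t) (L t)))\<^sup>2"
    define I where "I = (\<Sum>i\<in>-act. (L t $ i)\<^sup>2)"
    define m where "m = (norm (N t - ns))\<^sup>2 + (norm (L t - ls))\<^sup>2"
    have nn: "dx \<ge> 0" "c \<ge> 0" "I \<ge> 0" "m \<ge> 0" by (auto simp: dx_def c_def I_def m_def intro: sum_nonneg)
    have "W (X t) (N t) (L t) \<ge> w * (dx + I)" using elim(1) by (simp add: dx_def I_def)
    moreover have "e * ((Mm *v (X t - xs)) \<bullet> lin_rate t - G (X t) (N t) (L t) \<bullet> lin (N t) (L t))
       \<le> e * (- 1/2 * c + K * dx)"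
      using elim(2) e(1) by (intro mult_left_mono) (auto simp: dx_def c_def)
    moreover have "e * (- 1/2 * c + K * dx) \<le> - e / 2 * c + w / 2 * dx"
      using mult_right_mono[OF e(3) nn(1)] by (simp add: algebra_simps)
    \<comment> \<open>The part \<open>e / 2 * I\<close> joins \<open>e / 2 * c\<close> from the
      cross term, so that \<open>lin_coercive\<close> yields all multiplier errors.\<close>
    moreover have "w * (dx + I) \<ge> w * dx + e / 2 * I"
    proof -
      have "e * I \<ge> 0" using e(1) nn(3) by simp
      then show ?thesis
        using mult_right_mono[OF e(2) nn(3)] unfolding distrib_left by linarith
    qed
    moreover have "e / 2 * (\<kappa> * m) \<le> e / 2 * (c + I)"
      using \<kappa>(2)[of "N t" "L t"] e(1) by (intro mult_left_mono) (auto simp: c_def I_def m_def)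
    ultimately have "E' t \<le> - (w / 2 * dx) - e / 2 * \<kappa> * m"
      unfolding E'_def by (simp add: algebra_simps)
    moreover have "\<delta> * dx \<le> w / 2 * dx" "\<delta> * m \<le> e / 2 * \<kappa> * m"
      by (intro mult_right_mono nn; simp add: \<delta>_def)+
    moreover have "(norm (z t - zs))\<^sup>2 = dx + m" by (simp add: norm_z dx_def m_def)
    ultimately show ?case by (simp add: distrib_left)
  qed
  \<comment> \<open>\<open>T\<close> is taken nonnegative because the trajectory has derivatives
    only from time 0 on.\<close>
  then obtain T where T: "T \<ge> 0" "\<And>t. t \<ge> T \<Longrightarrow> E' t \<le> - \<delta> * (norm (z t - zs))\<^sup>2"
    unfolding eventually_at_top_linorder by (meson max.cobounded1 max.cobounded2 order_trans)
  define \<alpha> where "\<alpha> = \<delta> / v"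
  have "\<alpha> > 0" using pos by (simp add: \<alpha>_def)
  have decay: "E t \<le> E T * exp (- \<alpha> * (t - T))" if "t \<ge> T" for t
  proof (rule exponential_decay_from_derivative[OF _ _ that])
    show "(E has_real_derivative E' t) (at t within {T..})" if "t \<ge> T" for t
      unfolding E_def E'_def
      by (rule has_field_derivative_subset[of _ _ _ "{0..}"], intro DERIV_add DERIV_cmult deriv_V deriv_S)
         (use that T(1) in auto)
    show "E' t \<le> - \<alpha> * E t" if "t \<ge> T" for t
    proof -
      have "\<alpha> * E t \<le> \<alpha> * (v * (norm (z t - zs))\<^sup>2)"
        using E_le[of t] \<open>\<alpha> > 0\<close> by (intro mult_left_mono) auto
      also have "\<dots> = \<delta> * (norm (z t - zs))\<^sup>2" using pos by (simp add: \<alpha>_def)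
      finally show ?thesis using T(2)[OF that] by simp
    qed
  qed
  define C where "C = sqrt (2 * E T / v1)"
  define a where "a = \<alpha> / 2"
  \<comment> \<open>\<open>R\<close> covers the times before \<open>T\<close> and \<open>C\<close>
    those after it; the exponential moves the origin of the decay from \<open>T\<close> to 0. The
    rate \<open>a\<close> is half of \<open>\<alpha>\<close> since \<open>E\<close> controls the
    square of the distance.\<close>
  define q where "q = (R + C) * exp (a * T)"
  have "v1 / 2 * (norm (z T - zs))\<^sup>2 \<ge> 0" using v1(1) by simp
  with E_ge[of T] have "E T \<ge> 0" by (rule order_trans[rotated])
  then have "C \<ge> 0" using v1(1) by (simp add: C_def)
  have "a > 0" "q > 0" using \<open>\<alpha> > 0\<close> R(1) \<open>C \<ge> 0\<close> by (auto simp: a_def q_def)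
  moreover have "norm (z t - zs) \<le> q * exp (- a * t)" if "t \<ge> 0" for t
  proof -
    have qe: "q * exp (- a * t) = (R + C) * exp (- a * (t - T))"
      by (simp add: q_def mult.assoc algebra_simps flip: exp_add)
    show ?thesis
    proof (cases "t \<ge> T")
      case True
      have "(norm (z t - zs))\<^sup>2 \<le> 2 * E T / v1 * exp (- \<alpha> * (t - T))"
        using E_ge[of t] decay[OF True] v1(1) by (simp add: field_simps)
      then have "norm (z t - zs) \<le> sqrt (2 * E T / v1 * exp (- \<alpha> * (t - T)))"
        by (rule real_le_rsqrt)
      also have "\<dots> = C * exp (- a * (t - T))"
      proof -
        have "exp (- \<alpha> * (t - T)) = (exp (- a * (t - T)))\<^sup>2"
          by (simp add: a_def power2_eq_square flip: exp_add)
        then show ?thesis unfolding C_def by (simp only: real_sqrt_mult[of "2 * E T / v1"]) simp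
      qed
      also have "\<dots> \<le> (R + C) * exp (- a * (t - T))"
        using R(1) by (intro mult_right_mono) auto
      finally show ?thesis unfolding qe .
    next
      case False
      then have "exp (- a * (t - T)) \<ge> 1"
        using \<open>a > 0\<close> by (simp add: mult_le_0_iff)
      then have "(R + C) * 1 \<le> (R + C) * exp (- a * (t - T))"
        using R(1) \<open>C \<ge> 0\<close> by (intro mult_left_mono) auto
      then show ?thesis using R(2)[OF that] \<open>C \<ge> 0\<close> unfolding qe by simp
    qed
  qed
  ultimately show ?thesis by blast
qed

end

theorem theorem3p3:
  fixes f :: "real ^ 'n \<Rightarrow> real"
    and g :: "real ^ 'n \<Rightarrow> real ^ 'm"
    and A :: "real ^ 'n ^ 'p"
    and b :: "real ^ 'p"
    and x_star :: "real ^ 'n" and \<nu>_star :: "real ^ 'p" and \<xi>_star :: "real ^ 'm"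
  assumes "convex_on UNIV f"
    and "continuously_differentiable f"
    and "\<And>i. convex_on UNIV (\<lambda>x. g x $ i)"
    and "\<And>i. continuously_differentiable (\<lambda>x. g x $ i)"
    and "\<exists>x_bar. A *v x_bar = b \<and> (\<forall>i. g x_bar $ i < 0)"
    and "kkt_point f A b g (x_star, \<nu>_star, \<xi>_star)"
    and "twice_differentiable_at f x_star"
    and "\<And>i. twice_differentiable_at (\<lambda>x. g x $ i) x_star"
    and "strict_complementarity g x_star \<xi>_star"
    and "licq A g x_star"
    and "sosc f A g x_star \<xi>_star"
  shows "(\<forall>z. kkt_point f A b g z \<longrightarrow> z = (x_star, \<nu>_star, \<xi>_star)) \<and>
    (\<forall>kd_eq kp_eq ki_eq kp_in ki_in.
       kd_eq \<ge> 0 \<and> kp_eq > 0 \<and> ki_eq > 0 \<and> kp_in > 0 \<and> ki_in > 0 \<longrightarrow>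
       (\<forall>z. trajectory (sppid_field f A b g kd_eq kp_eq ki_eq kp_in ki_in) z \<longrightarrow>
            lin_exp_converges z (x_star, \<nu>_star, \<xi>_star)))"
proof -
  interpret regular_kkt f g A b x_star \<nu>_star \<xi>_star
    using assms by unfold_locales
  show ?thesis
  proof (intro conjI allI impI)
    \<comment> \<open>KKT points do not involve the gains, so any positive values serve.\<close>
    interpret sppid_gains f g A b x_star \<nu>_star \<xi>_star 1 1
      by unfold_locales auto
    fix z
    assume "kkt_point f A b g z"
    then show "z = (x_star, \<nu>_star, \<xi>_star)"
      by (cases z) (use kkt_point_unique in blast)
  next
    fix kd_eq kp_eq ki_eq kp_in ki_in z
    assume "kd_eq \<ge> 0 \<and> kp_eq > 0 \<and> ki_eq > 0 \<and> kp_in > 0 \<and> ki_in > 0"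
      and "trajectory (sppid_field f A b g kd_eq kp_eq ki_eq kp_in ki_in) z"
    then interpret sppid_trajectory f g A b x_star \<nu>_star \<xi>_star kp_eq kp_in kd_eq ki_eq ki_in z
      by unfold_locales auto
    show "lin_exp_converges z (x_star, \<nu>_star, \<xi>_star)"
      using exponential_convergence lin_exp_converges_of_exponential by blast
  qed
qed

end
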